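(* For every $c\in\mathbb{N}$, reachability on undirected graphs can be maintained in $\mathrm{DynFO}(\le,+,\times)$ under changes of size $\log^c n$, i.e. under changes that insert and/or delete at most $\log^c n$ edges at a time, where $n$ is the number of nodes.
   Context: Dynamic setting: the node set $V$ (of size $n$) is fixed; the input is an undirected graph $(V,E)$, initially with $E=\emptyset$, that is modified by changes, each inserting a set $E^+$ and deleting a set $E^-$ of edges; the size of a change is $|E^+|+|E^-|$. A dynamic program keeps auxiliary relations on $V$, initially empty. After each change, each auxiliary relation $T$ is replaced by the set of tuples satisfying a fixed first-order update formula for $T$, evaluated on the changed input graph, the old auxiliary relations, and built-in relations $\le,+,\times$ (a linear order on $V$ identified with $\{0,\dots,n-1\}$ and the corresponding addition and multiplication relations). The query (the set of pairs of nodes connected by a path) is maintained if a designated auxiliary relation equals it on the current graph after every non-empty sequence of changes of size at most $\log^c n$. $\mathrm{DynFO}(\le,+,\times)$ denotes the class of queries maintainable in this way. *)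

theory Defs
  imports Complex_Main
begin

section \<open>First-order formulas over the input graph, arithmetic and auxiliary relations\<close>

datatype symbol = Edge | Le | Plus | Times | Aux nat

datatype formula =
    Equal nat nat
  | Atom symbol "nat list"
  | Neg formula
  | Conj formula formula
  | Exists nat formula

type_synonym relation = "nat list set"

primrec holds :: "nat set \<Rightarrow> (symbol \<Rightarrow> relation) \<Rightarrow> (nat \<Rightarrow> nat) \<Rightarrow> formula \<Rightarrow> bool" where
  "holds U \<I> \<sigma> (Equal x y) \<longleftrightarrow> \<sigma> x = \<sigma> y"
| "holds U \<I> \<sigma> (Atom R xs) \<longleftrightarrow> map \<sigma> xs \<in> \<I> R"
| "holds U \<I> \<sigma> (Neg \<phi>) \<longleftrightarrow> \<not> holds U \<I> \<sigma> \<phi>"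
| "holds U \<I> \<sigma> (Conj \<phi> \<psi>) \<longleftrightarrow> holds U \<I> \<sigma> \<phi> \<and> holds U \<I> \<sigma> \<psi>"
| "holds U \<I> \<sigma> (Exists x \<phi>) \<longleftrightarrow> (\<exists>a\<in>U. holds U \<I> (\<sigma>(x := a)) \<phi>)"

primrec free_vars :: "formula \<Rightarrow> nat set" where
  "free_vars (Equal x y) = {x, y}"
| "free_vars (Atom R xs) = set xs"
| "free_vars (Neg \<phi>) = free_vars \<phi>"
| "free_vars (Conj \<phi> \<psi>) = free_vars \<phi> \<union> free_vars \<psi>"
| "free_vars (Exists x \<phi>) = free_vars \<phi> - {x}"

text \<open>The list \<open>ks\<close> gives the arities of the auxiliary symbols \<open>Aux 0\<close>, \<open>Aux 1\<close>, and so on.\<close>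

primrec has_arity :: "nat list \<Rightarrow> symbol \<Rightarrow> nat \<Rightarrow> bool" where
  "has_arity ks Edge k \<longleftrightarrow> k = 2"
| "has_arity ks Le k \<longleftrightarrow> k = 2"
| "has_arity ks Plus k \<longleftrightarrow> k = 3"
| "has_arity ks Times k \<longleftrightarrow> k = 3"
| "has_arity ks (Aux i) k \<longleftrightarrow> i < length ks \<and> k = ks ! i"

primrec wf_formula :: "nat list \<Rightarrow> formula \<Rightarrow> bool" where
  "wf_formula ks (Equal x y) \<longleftrightarrow> True"
| "wf_formula ks (Atom R xs) \<longleftrightarrow> has_arity ks R (length xs)"
| "wf_formula ks (Neg \<phi>) \<longleftrightarrow> wf_formula ks \<phi>"
| "wf_formula ks (Conj \<phi> \<psi>) \<longleftrightarrow> wf_formula ks \<phi> \<and> wf_formula ks \<psi>"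
| "wf_formula ks (Exists x \<phi>) \<longleftrightarrow> wf_formula ks \<phi>"


section \<open>Undirected graphs and changes\<close>

text \<open>
  A graph on the node set \<open>{..<n}\<close> is a set of unordered pairs, so that every undirected edge
  counts once in the size of a change. Singletons, i.e. self-loops, are permitted; since changes
  are arbitrary, loop-free inputs are covered as a special case.
\<close>

type_synonym graph = "nat set set"

definition edges_on :: "nat \<Rightarrow> nat set set" where
  "edges_on n = {{u, v} | u v. u < n \<and> v < n}"

text \<open>A change is the pair of the set of inserted edges and the set of deleted edges.\<close>

type_synonym change = "nat set set \<times> nat set set"

definition change_size :: "change \<Rightarrow> nat" where
  "change_size \<delta> = card (fst \<delta>) + card (snd \<delta>)"

definition change_on :: "nat \<Rightarrow> change \<Rightarrow> bool" where
  "change_on n \<delta> \<longleftrightarrow> fst \<delta> \<subseteq> edges_on n \<and> snd \<delta> \<subseteq> edges_on n"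

text \<open>
  The order of deletion and insertion is immaterial: if the two sets overlap, the
  resulting graph is also obtained by a smaller change with disjoint sets.
\<close>

definition apply_change :: "change \<Rightarrow> graph \<Rightarrow> graph" where
  "apply_change \<delta> E = (E - snd \<delta>) \<union> fst \<delta>"


section \<open>Dynamic programs\<close>

text \<open>
  The \<open>i\<close>-th entry \<open>(k, \<phi>)\<close> of the list says that \<open>Aux i\<close> has arity \<open>k\<close> and update formula \<open>\<phi>\<close>,
  in which the variables \<open>0, \<dots>, k - 1\<close> stand for the components of the tuple.
\<close>

datatype program = Program (aux: "(nat \<times> formula) list") (answer: nat)

definition wf_program :: "program \<Rightarrow> bool" where
  "wf_program P \<longleftrightarrow>
     answer P < length (aux P) \<and>
     (\<forall>(k, \<phi>) \<in> set (aux P). wf_formula (map fst (aux P)) \<phi> \<and> free_vars \<phi> \<subseteq> {..<k})"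

primrec interp :: "nat \<Rightarrow> graph \<Rightarrow> (nat \<Rightarrow> relation) \<Rightarrow> symbol \<Rightarrow> relation" where
  "interp n E A Edge = {[u, v] | u v. u < n \<and> v < n \<and> {u, v} \<in> E}"
| "interp n E A Le = {[a, b] | a b. a < n \<and> b < n \<and> a \<le> b}"
| "interp n E A Plus = {[a, b, d] | a b d. a < n \<and> b < n \<and> d < n \<and> a + b = d}"
| "interp n E A Times = {[a, b, d] | a b d. a < n \<and> b < n \<and> d < n \<and> a * b = d}"
| "interp n E A (Aux i) = A i"

definition defined_relation :: "nat \<Rightarrow> (symbol \<Rightarrow> relation) \<Rightarrow> nat \<Rightarrow> formula \<Rightarrow> relation" where
  "defined_relation n \<I> k \<phi> =
     {ts. length ts = k \<and> set ts \<subseteq> {..<n} \<and> holds {..<n} \<I> (\<lambda>j. ts ! j) \<phi>}"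

type_synonym state = "graph \<times> (nat \<Rightarrow> relation)"

definition initial_state :: state where
  "initial_state = ({}, \<lambda>i. {})"

definition update_state :: "program \<Rightarrow> nat \<Rightarrow> change \<Rightarrow> state \<Rightarrow> state" where
  "update_state P n \<delta> S =
     (let E' = apply_change \<delta> (fst S)
      in (E', \<lambda>i. if i < length (aux P)
                  then defined_relation n (interp n E' (snd S)) (fst (aux P ! i)) (snd (aux P ! i))
                  else {}))"

definition run :: "program \<Rightarrow> nat \<Rightarrow> change list \<Rightarrow> state" where
  "run P n \<delta>s = fold (update_state P n) \<delta>s initial_state"


section \<open>Maintaining queries\<close>

type_synonym query = "nat \<Rightarrow> graph \<Rightarrow> relation"

definition maintains :: "program \<Rightarrow> (nat \<Rightarrow> real) \<Rightarrow> query \<Rightarrow> bool" where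
  "maintains P s Q \<longleftrightarrow>
     (\<forall>n \<delta>s. \<delta>s \<noteq> [] \<longrightarrow>
        (\<forall>\<delta> \<in> set \<delta>s. change_on n \<delta> \<and> real (change_size \<delta>) \<le> s n) \<longrightarrow>
        snd (run P n \<delta>s) (answer P) = Q n (fst (run P n \<delta>s)))"

text \<open>
  The class \<open>DynFO(\<le>, +, \<times>)\<close> under changes of size at most \<open>s n\<close>, where \<open>n\<close> is the number of
  nodes. The program is uniform in \<open>n\<close>.
\<close>

definition DynFO :: "(nat \<Rightarrow> real) \<Rightarrow> query set" where
  "DynFO s = {Q. \<exists>P. wf_program P \<and> maintains P s Q}"

definition reachability :: query where
  "reachability n E = {[u, v] | u v. u < n \<and> v < n \<and> (u, v) \<in> {(x, y). {x, y} \<in> E}\<^sup>*}"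

end

theory Submission
  imports Defs "HOL-Number_Theory.Cong"
begin

text \<open>
  The program stores, for a spanning forest \<open>F\<close> of the graph, which edges of \<open>F\<close> lie on which paths
  of \<open>F\<close>. After a change, two nodes are still connected in what is left of \<open>F\<close> iff no deleted edge
  lies on the path between them. Every component of this rest that is not a full component of \<open>F\<close>, or
  that is incident to a new edge between components of \<open>F\<close>, contains an endpoint of a changed edge.
  So connectivity in the new graph, and in its subgraphs that Kruskal's algorithm asks for,
  reduces to connectivity among polylogarithmically many nodes.

  On polylogarithmically many nodes, reachability is first-order: for some \<open>m\<close> of polylogarithmic
  size the nodes are distinct modulo \<open>m\<close>, and a path of about \<open>(log n)\<^sup>1\<^sup>/\<^sup>4\<close> such residues
  is coded by two numbers below \<open>n\<close> with Goedel's beta function. Concatenating paths in this way a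
  constant number of times covers all paths that are needed. For the finitely many small \<open>n\<close>,
  paths of constant length suffice.
\<close>

section \<open>First-order definable predicates\<close>

text \<open>Two obstacles shape the proof. Formulas cannot count, so the relevant nodes cannot be
  named by their rank; remainders modulo a suitable number are definable from multiplication and
  give names of polylogarithmic size. That such a modulus exists follows from a lower bound on
  common multiples of \<open>1, ..., 2 * k\<close>. Moreover, formulas cannot choose replacement
  edges one after another. For a fixed total order of the edges, whether Kruskal's algorithm takes
  an edge is a single connectivity question about the smaller edges, so all edges are decided in
  parallel.

  The path relation can be updated because in a forest the path between two nodes consists of the
  edges whose removal separates them. The new path relation is thus again a connectivity question,
  in the new forest without one edge, and every update uses the one formula \<open>reach\<close>.

  The fourth root stems from the size of a beta code: \<open>K + 1\<close> entries need pairwise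
  coprime moduli, obtained from \<open>(K + 1)!\<close> and estimated by \<open>O(K ^ 2)\<close>
  bits each. A code then has \<open>O(K ^ 3)\<close> bits, and \<open>K ^ 4 \<le> log n\<close>
  absorbs the constant.\<close>

lemma holds_cong:
  assumes "\<And>x. x \<in> free_vars \<phi> \<Longrightarrow> \<sigma> x = \<tau> x"
  shows "holds U \<I> \<sigma> \<phi> \<longleftrightarrow> holds U \<I> \<tau> \<phi>"
  using assms
proof (induction \<phi> arbitrary: \<sigma> \<tau>)
  case (Atom R xs)
  then have "map \<sigma> xs = map \<tau> xs" by simp
  then show ?case by (simp only: holds.simps)
next
  case (Exists x \<phi>)
  have "holds U \<I> (\<sigma>(x := a)) \<phi> \<longleftrightarrow> holds U \<I> (\<tau>(x := a)) \<phi>" for a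
    by (rule Exists.IH) (use Exists.prems in auto)
  then show ?case by simp
next
  case (Neg \<phi>)
  have "holds U \<I> \<sigma> \<phi> \<longleftrightarrow> holds U \<I> \<tau> \<phi>"
    by (rule Neg.IH) (use Neg.prems in auto)
  then show ?case by simp
next
  case (Conj \<phi> \<psi>)
  have "holds U \<I> \<sigma> \<phi> \<longleftrightarrow> holds U \<I> \<tau> \<phi>" "holds U \<I> \<sigma> \<psi> \<longleftrightarrow> holds U \<I> \<tau> \<psi>"
    by (rule Conj.IH; use Conj.prems in auto)+
  then show ?case by simp
qed auto

lemma finite_free_vars: "finite (free_vars \<phi>)"
  by (induction \<phi>) auto

text \<open>The new bound variable lies outside the image of the other free variables, so nothing is
  captured even if \<open>f\<close> is not injective. A formula can therefore be applied to
  arguments that coincide.\<close>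

primrec rename :: "(nat \<Rightarrow> nat) \<Rightarrow> formula \<Rightarrow> formula" where
  "rename f (Equal x y) = Equal (f x) (f y)"
| "rename f (Atom R xs) = Atom R (map f xs)"
| "rename f (Neg \<phi>) = Neg (rename f \<phi>)"
| "rename f (Conj \<phi> \<psi>) = Conj (rename f \<phi>) (rename f \<psi>)"
| "rename f (Exists x \<phi>) =
     (let z = (SOME z. z \<notin> f ` (free_vars \<phi> - {x})) in Exists z (rename (f(x := z)) \<phi>))"

lemma fresh_var: "(SOME z::nat. z \<notin> f ` (free_vars \<phi> - {x})) \<notin> f ` (free_vars \<phi> - {x})"
  using ex_new_if_finite[OF infinite_UNIV_nat, of "f ` (free_vars \<phi> - {x})"]
  by (intro someI_ex[of "\<lambda>z. z \<notin> f ` (free_vars \<phi> - {x})"]) (simp add: finite_free_vars)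

lemma wf_rename: "wf_formula ks (rename f \<phi>) \<longleftrightarrow> wf_formula ks \<phi>"
  by (induction \<phi> arbitrary: f) (auto simp: Let_def)

lemma free_vars_rename: "free_vars (rename f \<phi>) \<subseteq> f ` free_vars \<phi>"
proof (induction \<phi> arbitrary: f)
  case (Exists x \<phi>)
  define z where "z = (SOME z. z \<notin> f ` (free_vars \<phi> - {x}))"
  have "free_vars (rename f (Exists x \<phi>)) = free_vars (rename (f(x := z)) \<phi>) - {z}"
    by (simp add: Let_def flip: z_def)
  also have "\<dots> \<subseteq> (f(x := z)) ` free_vars \<phi> - {z}"
    using Exists by blast
  also have "\<dots> \<subseteq> f ` free_vars (Exists x \<phi>)"
    by (auto split: if_splits)
  finally show ?case .
next
  case (Conj \<phi> \<psi>)
  then show ?case by fastforce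
qed auto

lemma holds_rename: "holds U \<I> \<sigma> (rename f \<phi>) \<longleftrightarrow> holds U \<I> (\<lambda>x. \<sigma> (f x)) \<phi>"
proof (induction \<phi> arbitrary: f \<sigma>)
  case (Exists x \<phi>)
  define z where "z = (SOME z. z \<notin> f ` (free_vars \<phi> - {x}))"
  have z: "z \<notin> f ` (free_vars \<phi> - {x})"
    unfolding z_def by (rule fresh_var)
  have "holds U \<I> (\<sigma>(z := a)) (rename (f(x := z)) \<phi>) \<longleftrightarrow>
      holds U \<I> ((\<lambda>x. \<sigma> (f x))(x := a)) \<phi>" for a
    unfolding Exists.IH by (rule holds_cong) (use z in auto)
  then show ?case by (simp add: Let_def flip: z_def)
qed (auto simp: comp_def)

text \<open>
  Predicates are stated over an arbitrary type of environments, whose components are accessed by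
  a list of functions; the \<open>j\<close>-th function interprets the variable \<open>j\<close>. Binding a variable pairs the
  environment with the new value. The arities \<open>[4, 2]\<close> are those of the path relation of the forest
  and of the answer.
\<close>

type_synonym struct = "nat \<times> graph \<times> (nat \<Rightarrow> relation)"

definition expresses :: "formula \<Rightarrow> ('e \<Rightarrow> nat) list \<Rightarrow> (struct \<Rightarrow> 'e \<Rightarrow> bool) \<Rightarrow> bool" where
  "expresses \<phi> xs \<Phi> \<longleftrightarrow> wf_formula [4, 2] \<phi> \<and> free_vars \<phi> \<subseteq> {..<length xs} \<and>
     (\<forall>n E A e. (\<forall>x\<in>set xs. x e < n) \<longrightarrow>
        (holds {..<n} (interp n E A) (\<lambda>j. (xs ! j) e) \<phi> \<longleftrightarrow> \<Phi> (n, E, A) e))"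

definition fo :: "('e \<Rightarrow> nat) list \<Rightarrow> (struct \<Rightarrow> 'e \<Rightarrow> bool) \<Rightarrow> bool" where
  "fo xs \<Phi> \<longleftrightarrow> (\<exists>\<phi>. expresses \<phi> xs \<Phi>)"

definition lift :: "('e \<Rightarrow> nat) list \<Rightarrow> ('e \<times> nat \<Rightarrow> nat) list" where
  "lift xs = map (\<lambda>x p. x (fst p)) xs @ [snd]"

lemma in_lift:
  "x \<in> set xs \<Longrightarrow> (\<lambda>p. x (fst p)) \<in> set (lift xs)"
  "snd \<in> set (lift xs)"
  by (auto simp: lift_def)

lemma expressesD:
  assumes "expresses \<phi> xs \<Phi>"
  shows "wf_formula [4, 2] \<phi>" "free_vars \<phi> \<subseteq> {..<length xs}"
    "\<And>n E A e. (\<And>x. x \<in> set xs \<Longrightarrow> x e < n) \<Longrightarrow>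
        holds {..<n} (interp n E A) (\<lambda>j. (xs ! j) e) \<phi> \<longleftrightarrow> \<Phi> (n, E, A) e"
  using assms unfolding expresses_def by blast+

lemma foI:
  assumes "wf_formula [4, 2] \<phi>" "free_vars \<phi> \<subseteq> {..<length xs}"
    "\<And>n E A e. (\<And>x. x \<in> set xs \<Longrightarrow> x e < n) \<Longrightarrow>
        holds {..<n} (interp n E A) (\<lambda>j. (xs ! j) e) \<phi> \<longleftrightarrow> \<Phi> (n, E, A) e"
  shows "fo xs \<Phi>"
  using assms unfolding fo_def expresses_def by blast

lemma fo_cong:
  assumes "fo xs \<Phi>"
    "\<And>n E A e. (\<And>x. x \<in> set xs \<Longrightarrow> x e < n) \<Longrightarrow> \<Phi> (n, E, A) e \<longleftrightarrow> \<Psi> (n, E, A) e"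
  shows "fo xs \<Psi>"
proof -
  obtain \<phi> where \<phi>: "expresses \<phi> xs \<Phi>" using assms(1) unfolding fo_def ..
  show ?thesis
  proof (rule foI[OF expressesD(1,2)[OF \<phi>]])
    fix n E A e assume e: "\<And>x. x \<in> set xs \<Longrightarrow> x e < n"
    show "holds {..<n} (interp n E A) (\<lambda>j. (xs ! j) e) \<phi> \<longleftrightarrow> \<Psi> (n, E, A) e"
      by (rule trans[OF expressesD(3)[OF \<phi>] assms(2)]) (rule e, assumption)+
  qed
qed

text \<open>This reuses a definable predicate with other arguments and below further binders:
  \<open>h\<close> sends each position of \<open>xs\<close> to a position of \<open>ys\<close> that
  carries the same value.\<close>

lemma fo_subst:
  assumes "fo xs \<Phi>" "\<And>x. x \<in> set xs \<Longrightarrow> (\<lambda>f. x (g f)) \<in> set ys"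
  shows "fo ys (\<lambda>S f. \<Phi> S (g f))"
proof -
  obtain \<phi> where \<phi>: "expresses \<phi> xs \<Phi>" using assms(1) unfolding fo_def ..
  note fv = expressesD(2)[OF \<phi>]
  have "\<exists>i. i < length ys \<and> ys ! i = (\<lambda>f. (xs ! j) (g f))" if "j < length xs" for j
    using assms(2)[OF nth_mem[OF that]] unfolding in_set_conv_nth .
  then obtain h where h: "\<And>j. j < length xs \<Longrightarrow> h j < length ys \<and> ys ! h j = (\<lambda>f. (xs ! j) (g f))"
    by metis
  show ?thesis
  proof (rule foI)
    show "wf_formula [4, 2] (rename h \<phi>)"
      using expressesD(1)[OF \<phi>] by (simp add: wf_rename)
    show "free_vars (rename h \<phi>) \<subseteq> {..<length ys}"
      using free_vars_rename[of h \<phi>] fv h by fastforce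
    fix n E A e
    assume e: "\<And>y. y \<in> set ys \<Longrightarrow> y e < n"
    have "holds {..<n} (interp n E A) (\<lambda>j. (ys ! j) e) (rename h \<phi>) \<longleftrightarrow>
      holds {..<n} (interp n E A) (\<lambda>j. (xs ! j) (g e)) \<phi>"
      unfolding holds_rename
    proof (rule holds_cong)
      fix j assume "j \<in> free_vars \<phi>"
      then have "j < length xs" using fv by auto
      then show "(ys ! h j) e = (xs ! j) (g e)" using h by simp
    qed
    also have "\<dots> \<longleftrightarrow> \<Phi> (n, E, A) (g e)"
      using e[OF assms(2)] by (rule expressesD(3)[OF \<phi>])
    finally show "holds {..<n} (interp n E A) (\<lambda>j. (ys ! j) e) (rename h \<phi>) \<longleftrightarrow> \<Phi> (n, E, A) (g e)" .
  qed
qed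

section \<open>Closure properties and atomic predicates\<close>

lemma fo_not:
  assumes "fo xs \<Phi>"
  shows "fo xs (\<lambda>S e. \<not> \<Phi> S e)"
proof -
  obtain \<phi> where \<phi>: "expresses \<phi> xs \<Phi>" using assms(1) unfolding fo_def ..
  show ?thesis
    by (rule foI[of "Neg \<phi>"])
      (simp_all only: holds.simps wf_formula.simps free_vars.simps expressesD[OF \<phi>])
qed

lemma fo_conj:
  assumes "fo xs \<Phi>" "fo xs \<Psi>"
  shows "fo xs (\<lambda>S e. \<Phi> S e \<and> \<Psi> S e)"
proof -
  obtain \<phi> where \<phi>: "expresses \<phi> xs \<Phi>" using assms(1) unfolding fo_def ..
  obtain \<psi> where \<psi>: "expresses \<psi> xs \<Psi>" using assms(2) unfolding fo_def ..
  show ?thesis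
    by (rule foI[of "Conj \<phi> \<psi>"])
      (simp_all only: holds.simps wf_formula.simps free_vars.simps expressesD[OF \<phi>]
        expressesD[OF \<psi>] Un_subset_iff)
qed

lemma fo_ex:
  assumes "fo (lift xs) (\<lambda>S p. \<Phi> S (fst p) (snd p))"
  shows "fo xs (\<lambda>S e. \<exists>a<fst S. \<Phi> S e a)"
proof -
  obtain \<phi> where \<phi>: "expresses \<phi> (lift xs) (\<lambda>S p. \<Phi> S (fst p) (snd p))"
    using assms(1) unfolding fo_def ..
  have fv: "free_vars \<phi> \<subseteq> {..<Suc (length xs)}"
    using expressesD(2)[OF \<phi>] by (simp add: lift_def)
  \<comment> \<open>The bound variable gets the number \<open>length xs\<close>, the position at
    which \<open>lift\<close> appends \<open>snd\<close>.\<close>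
  show ?thesis
  proof (rule foI[of "Exists (length xs) \<phi>"])
    show "wf_formula [4, 2] (Exists (length xs) \<phi>)" using expressesD(1)[OF \<phi>] by simp
    show "free_vars (Exists (length xs) \<phi>) \<subseteq> {..<length xs}"
      using fv by (auto simp: less_Suc_eq)
    fix n E A e
    assume e: "\<And>x. x \<in> set xs \<Longrightarrow> x e < n"
    have "holds {..<n} (interp n E A) ((\<lambda>j. (xs ! j) e)(length xs := a)) \<phi> \<longleftrightarrow> \<Phi> (n, E, A) e a"
      if "a < n" for a
    proof -
      have "holds {..<n} (interp n E A) ((\<lambda>j. (xs ! j) e)(length xs := a)) \<phi> \<longleftrightarrow>
          holds {..<n} (interp n E A) (\<lambda>j. (lift xs ! j) (e, a)) \<phi>"
      proof (rule holds_cong)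
        fix j assume "j \<in> free_vars \<phi>"
        then have "j < length xs \<or> j = length xs" using fv by auto
        then show "((\<lambda>j. (xs ! j) e)(length xs := a)) j = (lift xs ! j) (e, a)"
          by (auto simp: lift_def nth_append)
      qed
      also have "\<dots> \<longleftrightarrow> \<Phi> (n, E, A) (fst (e, a)) (snd (e, a))"
      proof (rule expressesD(3)[OF \<phi>])
        fix x assume "x \<in> set (lift xs)"
        then show "x (e, a) < n" using e that by (auto simp: lift_def)
      qed
      finally show ?thesis by simp
    qed
    then show "holds {..<n} (interp n E A) (\<lambda>j. (xs ! j) e) (Exists (length xs) \<phi>) \<longleftrightarrow>
        (\<exists>a<fst (n, E, A). \<Phi> (n, E, A) e a)"
      by (simp add: Bex_def)
  qed
qed

lemma fo_atom:
  assumes "set ts \<subseteq> set xs" "has_arity [4, 2] R (length ts)"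
  shows "fo xs (\<lambda>S e. map (\<lambda>t. t e) ts \<in> interp (fst S) (fst (snd S)) (snd (snd S)) R)"
proof -
  have "\<exists>i. i < length xs \<and> xs ! i = t" if "t \<in> set ts" for t
    using subsetD[OF assms(1) that] unfolding in_set_conv_nth .
  then obtain h where h: "\<And>t. t \<in> set ts \<Longrightarrow> h t < length xs \<and> xs ! h t = t"
    by metis
  show ?thesis
  proof (rule foI[of "Atom R (map h ts)"])
    fix n E A e
    have "map (\<lambda>j. (xs ! j) e) (map h ts) = map (\<lambda>t. t e) ts"
      by (simp add: h)
    then show "holds {..<n} (interp n E A) (\<lambda>j. (xs ! j) e) (Atom R (map h ts)) \<longleftrightarrow>
      map (\<lambda>t. t e) ts \<in> interp (fst (n, E, A)) (fst (snd (n, E, A))) (snd (snd (n, E, A))) R"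
      by (simp only: holds.simps fst_conv snd_conv)
  qed (use h assms(2) in auto)
qed

lemma fo_or: "fo xs \<Phi> \<Longrightarrow> fo xs \<Psi> \<Longrightarrow> fo xs (\<lambda>S e. \<Phi> S e \<or> \<Psi> S e)"
  by (rule fo_cong[OF fo_not[OF fo_conj[OF fo_not fo_not]]]) auto

lemma fo_imp: "fo xs \<Phi> \<Longrightarrow> fo xs \<Psi> \<Longrightarrow> fo xs (\<lambda>S e. \<Phi> S e \<longrightarrow> \<Psi> S e)"
  by (rule fo_cong[OF fo_or[OF fo_not]]) auto

lemma fo_all:
  "fo (lift xs) (\<lambda>S p. \<Phi> S (fst p) (snd p)) \<Longrightarrow> fo xs (\<lambda>S e. \<forall>a<fst S. \<Phi> S e a)"
  by (rule fo_cong[OF fo_not[OF fo_ex[OF fo_not]]]) auto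

lemma fo_le: "x \<in> set xs \<Longrightarrow> y \<in> set xs \<Longrightarrow> fo xs (\<lambda>S e. x e \<le> y e)"
  by (rule fo_cong[OF fo_atom[of "[x, y]" _ Le]]) auto

lemma fo_less: "x \<in> set xs \<Longrightarrow> y \<in> set xs \<Longrightarrow> fo xs (\<lambda>S e. x e < y e)"
  by (rule fo_cong[OF fo_not[OF fo_le[of y xs x]]]) auto

lemma fo_eq: "x \<in> set xs \<Longrightarrow> y \<in> set xs \<Longrightarrow> fo xs (\<lambda>S e. x e = y e)"
  by (rule fo_cong[OF fo_conj[OF fo_le[of x xs y] fo_le[of y xs x]]]) auto

lemma fo_plus: "x \<in> set xs \<Longrightarrow> y \<in> set xs \<Longrightarrow> z \<in> set xs \<Longrightarrow> fo xs (\<lambda>S e. x e + y e = z e)"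
  by (rule fo_cong[OF fo_atom[of "[x, y, z]" _ Plus]]) auto

lemma fo_times: "x \<in> set xs \<Longrightarrow> y \<in> set xs \<Longrightarrow> z \<in> set xs \<Longrightarrow> fo xs (\<lambda>S e. x e * y e = z e)"
  by (rule fo_cong[OF fo_atom[of "[x, y, z]" _ Times]]) auto

lemma fo_edge: "x \<in> set xs \<Longrightarrow> y \<in> set xs \<Longrightarrow> fo xs (\<lambda>S e. {x e, y e} \<in> fst (snd S))"
  by (rule fo_cong[OF fo_atom[of "[x, y]" _ Edge]]) auto

lemma fo_aux:
  "x \<in> set xs \<Longrightarrow> y \<in> set xs \<Longrightarrow> z \<in> set xs \<Longrightarrow> w \<in> set xs \<Longrightarrow>
   fo xs (\<lambda>S e. [x e, y e, z e, w e] \<in> snd (snd S) 0)"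
  by (rule fo_cong[OF fo_atom[of "[x, y, z, w]" _ "Aux 0"]]) auto

lemmas fo_intros = fo_not fo_conj fo_or fo_imp fo_ex fo_all fo_le fo_less fo_eq fo_plus fo_times
  fo_edge fo_aux

lemma fo_suc:
  assumes "x \<in> set xs" "y \<in> set xs"
  shows "fo xs (\<lambda>S e. y e = Suc (x e))"
proof (rule fo_cong)
  show "fo xs (\<lambda>S e. x e < y e \<and> \<not> (\<exists>z<fst S. x e < z \<and> z < y e))"
    by (intro fo_intros assms in_lift)
  fix n E A e assume e: "\<And>x. x \<in> set xs \<Longrightarrow> x e < n"
  have "y e < n" using e assms by blast
  then show "(x e < y e \<and> \<not> (\<exists>z<fst (n, E, A). x e < z \<and> z < y e)) = (y e = Suc (x e))"
    by (metis fst_conv leD lessI less_trans not_less_eq not_less_iff_gr_or_eq order.strict_trans)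
qed

lemma fo_pos:
  assumes "x \<in> set xs"
  shows "fo xs (\<lambda>S e. 0 < x e)"
proof (rule fo_cong)
  show "fo xs (\<lambda>S e. \<exists>z<fst S. z < x e)"
    by (intro fo_intros assms in_lift)
  fix n E A e assume e: "\<And>x. x \<in> set xs \<Longrightarrow> x e < n"
  have "x e < n" using e assms by blast
  then show "(\<exists>z<fst (n, E, A). z < x e) \<longleftrightarrow> 0 < x e"
    by (auto intro: exI[of _ 0])
qed

definition residue :: "nat \<Rightarrow> nat \<Rightarrow> nat \<Rightarrow> bool" where
  "residue m x a \<longleftrightarrow> 0 < m \<and> x mod m = a"

text \<open>Goedel's beta function: \<open>(w, d)\<close> is a code of a sequence with entry \<open>a\<close> at position \<open>i\<close>.\<close>

definition beta :: "nat \<Rightarrow> nat \<Rightarrow> nat \<Rightarrow> nat \<Rightarrow> nat \<Rightarrow> bool" where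
  "beta n w d i a \<longleftrightarrow> Suc (i * d) < n \<and> w mod Suc (i * d) = a"

lemma fo_residue:
  assumes "x \<in> set xs" "m \<in> set xs" "a \<in> set xs"
  shows "fo xs (\<lambda>S e. residue (m e) (x e) (a e))"
proof (rule fo_cong)
  \<comment> \<open>\<open>a e < m e\<close> forces a positive modulus. Quotient and product are at
    most \<open>x e\<close>, so quantifying them over the nodes loses nothing.\<close>
  show "fo xs (\<lambda>S e. a e < m e \<and> (\<exists>r<fst S. \<exists>s<fst S. m e * r = s \<and> s + a e = x e))"
    by (intro fo_intros assms in_lift)
  fix n E A e assume e: "\<And>x. x \<in> set xs \<Longrightarrow> x e < n"
  have x: "x e < n" using e assms(1) by blast
  show "(a e < m e \<and> (\<exists>r<fst (n, E, A). \<exists>s<fst (n, E, A). m e * r = s \<and> s + a e = x e)) =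
     residue (m e) (x e) (a e)" (is "?L \<longleftrightarrow> ?R")
    unfolding residue_def
  proof
    assume ?L
    then obtain r where "a e < m e" "m e * r + a e = x e" by auto
    then show "0 < m e \<and> x e mod m e = a e"
      by (metis less_nat_zero_code linorder_not_less mod_less mod_mult_self4 neq0_conv)
  next
    assume r: "0 < m e \<and> x e mod m e = a e"
    have "x e div m e < n" "m e * (x e div m e) < n"
      using x by (meson div_le_dividend le_less_trans, meson le_less_trans times_div_less_eq_dividend)
    moreover have "m e * (x e div m e) + a e = x e"
      using r by (metis mult_div_mod_eq)
    ultimately show ?L
      using r mod_less_divisor[of "m e" "x e"] by auto
  qed
qed

lemma fo_beta:
  assumes "w \<in> set xs" "d \<in> set xs" "i \<in> set xs" "a \<in> set xs"
  shows "fo xs (\<lambda>S e. beta (fst S) (w e) (d e) (i e) (a e))"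
proof (rule fo_cong)
  show "fo xs (\<lambda>S e. \<exists>p<fst S. \<exists>q<fst S. i e * d e = p \<and> q = Suc p \<and> residue q (w e) (a e))"
    by (intro fo_intros fo_suc fo_residue assms in_lift)
qed (auto simp: residue_def beta_def)

section \<open>Reachability through a small set of nodes\<close>

primrec walk :: "nat \<Rightarrow> (nat \<Rightarrow> nat \<Rightarrow> bool) \<Rightarrow> nat \<Rightarrow> nat \<Rightarrow> nat \<Rightarrow> bool" where
  "walk n R 0 u v \<longleftrightarrow> u = v"
| "walk n R (Suc l) u v \<longleftrightarrow> (\<exists>w<n. walk n R l u w \<and> R w v)"

text \<open>If one code holds \<open>K\<close> steps, level \<open>j\<close> covers
  \<open>K ^ j\<close> steps. Equality at level 0 allows shorter paths to be padded. The end
  positions are quantified, so the formula does not mention \<open>K\<close> and is the same for all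
  \<open>n\<close>.\<close>

primrec coded :: "nat \<Rightarrow> (nat \<Rightarrow> nat \<Rightarrow> bool) \<Rightarrow> nat \<Rightarrow> nat \<Rightarrow> nat \<Rightarrow> bool" where
  "coded n T 0 a b \<longleftrightarrow> T a b \<or> a = b"
| "coded n T (Suc j) a b \<longleftrightarrow> (\<exists>w<n. \<exists>d<n. \<exists>i<n. \<exists>k<n. i \<le> k \<and> beta n w d i a \<and> beta n w d k b \<and>
     (\<forall>l<n. \<forall>l'<n. \<forall>x<n. \<forall>y<n. i \<le> l \<and> l' = Suc l \<and> l' \<le> k \<and> beta n w d l x \<and> beta n w d l' y
        \<longrightarrow> coded n T j x y))"

definition link :: "nat \<Rightarrow> (nat \<Rightarrow> nat \<Rightarrow> bool) \<Rightarrow> (nat \<Rightarrow> nat \<Rightarrow> bool) \<Rightarrow> nat \<Rightarrow> nat \<Rightarrow> bool" where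
  "link n B Z x y \<longleftrightarrow> B x y \<or> (\<exists>s<n. \<exists>t<n. B x s \<and> Z s t \<and> B t y)"

text \<open>The node \<open>x\<close> is given the name \<open>x mod m\<close>.\<close>

definition link_names ::
    "nat \<Rightarrow> (nat \<Rightarrow> nat \<Rightarrow> bool) \<Rightarrow> (nat \<Rightarrow> bool) \<Rightarrow> (nat \<Rightarrow> nat \<Rightarrow> bool) \<Rightarrow> nat \<Rightarrow> nat \<Rightarrow> nat \<Rightarrow> bool" where
  "link_names n B X Z m a b \<longleftrightarrow> (\<exists>x<n. \<exists>y<n. X x \<and> X y \<and> link n B Z x y \<and>
     residue m x a \<and> residue m y b)"

definition naming :: "nat \<Rightarrow> (nat \<Rightarrow> bool) \<Rightarrow> nat \<Rightarrow> bool" where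
  "naming n X m \<longleftrightarrow> 0 < m \<and> (\<forall>p<n. \<forall>q<n. \<forall>a<n.
     X p \<and> X q \<and> residue m p a \<and> residue m q a \<longrightarrow> p = q)"

text \<open>The first disjunct settles small \<open>n\<close>, where \<open>L\<close> exceeds the
  length of all paths that are needed. The second is for nodes whose component of \<open>B\<close>
  contains no node of \<open>X\<close>. The modulus is guessed and checked by
  \<open>naming\<close>.\<close>

definition reach ::
    "nat \<Rightarrow> nat \<Rightarrow> nat \<Rightarrow> (nat \<Rightarrow> nat \<Rightarrow> bool) \<Rightarrow> (nat \<Rightarrow> bool) \<Rightarrow> (nat \<Rightarrow> nat \<Rightarrow> bool) \<Rightarrow> nat \<Rightarrow> nat \<Rightarrow> bool" where
  "reach L t n B X Z u v \<longleftrightarrow> walk n (\<lambda>x y. B x y \<or> Z x y) L u v \<or> B u v \<or>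
     (\<exists>m<n. naming n X m \<and> (\<exists>x<n. \<exists>y<n. X x \<and> X y \<and> B u x \<and> B y v \<and>
        (\<exists>a<n. residue m x a \<and> (\<exists>b<n. residue m y b \<and> coded n (link_names n B X Z m) t a b))))"

text \<open>Unary and binary relations that depend on the environment are treated as arguments, so
  that definability of operators such as \<open>walk\<close> and \<open>coded\<close> can be stated
  for all definable relations.\<close>

definition fo1 :: "('e \<Rightarrow> nat) list \<Rightarrow> (struct \<Rightarrow> 'e \<Rightarrow> nat \<Rightarrow> bool) \<Rightarrow> bool" where
  "fo1 xs X \<longleftrightarrow> fo (lift xs) (\<lambda>S q. X S (fst q) (snd q))"

definition fo2 :: "('e \<Rightarrow> nat) list \<Rightarrow> (struct \<Rightarrow> 'e \<Rightarrow> nat \<Rightarrow> nat \<Rightarrow> bool) \<Rightarrow> bool" where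
  "fo2 xs R \<longleftrightarrow> fo (lift (lift xs)) (\<lambda>S q. R S (fst (fst q)) (snd (fst q)) (snd q))"

lemma fo1_app:
  assumes "fo1 xs X" "\<And>x. x \<in> set xs \<Longrightarrow> (\<lambda>f. x (g f)) \<in> set ys" "u \<in> set ys"
  shows "fo ys (\<lambda>S f. X S (g f) (u f))"
proof -
  have "fo ys (\<lambda>S f. X S (fst (g f, u f)) (snd (g f, u f)))"
    using assms(1) unfolding fo1_def
    by (rule fo_subst) (use assms(2,3) in \<open>auto simp: lift_def\<close>)
  then show ?thesis by simp
qed

lemma fo2_app:
  assumes "fo2 xs R" "\<And>x. x \<in> set xs \<Longrightarrow> (\<lambda>f. x (g f)) \<in> set ys" "u \<in> set ys" "v \<in> set ys"
  shows "fo ys (\<lambda>S f. R S (g f) (u f) (v f))"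
proof -
  let ?h = "\<lambda>f. ((g f, u f), v f)"
  have "fo ys (\<lambda>S f. R S (fst (fst (?h f))) (snd (fst (?h f))) (snd (?h f)))"
    using assms(1) unfolding fo2_def
    by (rule fo_subst) (use assms(2-4) in \<open>auto simp: lift_def\<close>)
  then show ?thesis by simp
qed

lemma fo2_walk:
  assumes "fo2 xs R"
  shows "fo2 xs (\<lambda>S e. walk (fst S) (R S e) l)"
proof (induction l)
  case 0
  show ?case unfolding fo2_def walk.simps by (intro fo_intros in_lift)
next
  case (Suc l)
  show ?case unfolding fo2_def walk.simps
    by (intro fo_intros fo2_app[OF Suc] fo2_app[OF assms] in_lift; assumption)
qed

lemma fo2_coded:
  assumes "fo2 xs T"
  shows "fo2 xs (\<lambda>S e. coded (fst S) (T S e) j)"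
proof (induction j)
  case 0
  show ?case unfolding fo2_def coded.simps
    by (intro fo_intros fo2_app[OF assms] in_lift; assumption)
next
  case (Suc j)
  show ?case unfolding fo2_def coded.simps
    by (intro fo_intros fo_suc fo_beta fo2_app[OF Suc] in_lift; assumption)
qed

lemma fo2_link:
  assumes "fo2 xs B" "fo2 xs Z"
  shows "fo2 xs (\<lambda>S e. link (fst S) (B S e) (Z S e))"
  unfolding fo2_def link_def
  by (intro fo_intros fo2_app[OF assms(1)] fo2_app[OF assms(2)] in_lift; assumption)

lemma fo2_link_names:
  assumes "fo2 xs B" "fo1 xs X" "fo2 xs Z"
  shows "fo2 (lift xs)
    (\<lambda>S p. link_names (fst S) (B S (fst p)) (X S (fst p)) (Z S (fst p)) (snd p))"
  unfolding fo2_def link_names_def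
  by (intro fo_conj fo_ex fo_residue fo2_app[OF fo2_link[OF assms(1,3)]] fo1_app[OF assms(2)] in_lift; assumption)

lemma fo1_naming:
  assumes "fo1 xs X"
  shows "fo1 xs (\<lambda>S e. naming (fst S) (X S e))"
  unfolding fo1_def naming_def
  by (intro fo_conj fo_all fo_imp fo_eq fo_pos fo_residue fo1_app[OF assms] in_lift; assumption)

lemma fo_reach:
  assumes "fo2 xs B" "fo1 xs X" "fo2 xs Z" "u \<in> set xs" "v \<in> set xs"
  shows "fo xs (\<lambda>S e. reach L t (fst S) (B S e) (X S e) (Z S e) (u e) (v e))"
proof -
  have BZ: "fo2 xs (\<lambda>S e x y. B S e x y \<or> Z S e x y)"
    using assms(1,3) unfolding fo2_def by (intro fo_or)
  show ?thesis
    unfolding reach_def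
    by (intro fo_or fo_conj fo_ex fo_residue fo2_app[OF fo2_walk[OF BZ]] fo2_app[OF assms(1)]
        fo1_app[OF assms(2)] fo1_app[OF fo1_naming[OF assms(2)]]
        fo2_app[OF fo2_coded[OF fo2_link_names[OF assms(1-3)]]] in_lift assms(4,5); assumption)
qed

section \<open>Soundness and completeness of coded paths\<close>

lemma relpow_mult: "(R ^^ (k * l)) = (R ^^ k) ^^ l" for R :: "('a \<times> 'a) set"
  by (induction l) (simp_all add: relpow_add flip: relpow_commute)

text \<open>The length is bounded by the number of pairs in \<open>R\<close>; this crude bound is
  why \<open>n * n\<close> and \<open>M * M\<close> appear in the later conditions on
  \<open>L\<close> and \<open>K ^ t\<close>.\<close>

lemma rtrancl_bounded_relpow:
  fixes R :: "(nat \<times> nat) set"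
  assumes "R \<subseteq> {..<n} \<times> {..<n}" "(x, y) \<in> R\<^sup>*"
  obtains l where "l \<le> n * n" "(x, y) \<in> R ^^ l"
proof -
  have "finite R" using assms(1) by (rule finite_subset) simp
  moreover have "card R \<le> n * n"
    using card_mono[OF _ assms(1)] by (simp add: card_cartesian_product)
  ultimately show ?thesis
    using assms(2) that unfolding rtrancl_finite_eq_relpow[OF \<open>finite R\<close>]
    by (auto dest: le_trans)
qed

text \<open>Any \<open>w\<close> and \<open>d\<close> are sound: remainders determine one entry per
  position, and the modulus at \<open>k\<close> being below \<open>n\<close> keeps all earlier
  moduli below \<open>n\<close>. So the quantifiers see every consecutive pair between
  \<open>i\<close> and \<open>k\<close>.\<close>

lemma coded_sound:
  assumes "coded n T j a b"
  shows "T\<^sup>*\<^sup>* a b"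
  using assms
proof (induction j arbitrary: a b)
  case 0
  then show ?case by auto
next
  case (Suc j)
  then obtain w d i k where wd: "w < n" "k < n" "i \<le> k" "beta n w d i a" "beta n w d k b"
    and step: "\<forall>l<n. \<forall>l'<n. \<forall>x<n. \<forall>y<n. i \<le> l \<and> l' = Suc l \<and> l' \<le> k \<and>
      beta n w d l x \<and> beta n w d l' y \<longrightarrow> coded n T j x y"
    by auto
  define f where "f l = w mod Suc (l * d)" for l
  have f: "beta n w d l (f l)" "f l < n" if "l \<le> k" for l
  proof -
    have "l * d \<le> k * d" "Suc (k * d) < n" using that wd(5) by (simp_all add: beta_def)
    then have "Suc (l * d) < n" by linarith
    then show "beta n w d l (f l)" by (simp add: beta_def f_def)
    show "f l < n" unfolding f_def using wd(1) by (meson le_less_trans mod_less_eq_dividend)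
  qed
  have "coded n T j (f l) (f (Suc l))" if "i \<le> l" "Suc l \<le> k" for l
    using step[rule_format, of l "Suc l" "f l" "f (Suc l)"] f[of l] f[of "Suc l"] that wd(2) by simp
  then have T: "T\<^sup>*\<^sup>* (f l) (f (Suc l))" if "i \<le> l" "Suc l \<le> k" for l
    using Suc.IH that by blast
  have "T\<^sup>*\<^sup>* a (f l)" if "i \<le> l" "l \<le> k" for l
    using that
  proof (induction l rule: dec_induct)
    case base
    have "f i = a" using wd(4) by (simp add: beta_def f_def)
    then show ?case by simp
  next
    case (step l)
    have "T\<^sup>*\<^sup>* a (f l)" "T\<^sup>*\<^sup>* (f l) (f (Suc l))" using step T by simp_all
    then show ?case by (rule rtranclp_trans)
  qed
  from this[of k] have "T\<^sup>*\<^sup>* a (f k)" using wd by simp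
  moreover have "f k = b" using wd(5) by (simp add: beta_def f_def)
  ultimately show ?case by simp
qed

text \<open>Entries are stored from position 1 on, because the modulus at position 0 is 1 and every
  entry there would be 0.\<close>

definition codes :: "nat \<Rightarrow> nat \<Rightarrow> nat \<Rightarrow> bool" where
  "codes n M K \<longleftrightarrow> (\<forall>f. (\<forall>i\<le>K. f i < M) \<longrightarrow>
     (\<exists>w<n. \<exists>d<n. Suc K < n \<and> (\<forall>i\<le>K. beta n w d (Suc i) (f i))))"

text \<open>A path of \<open>K ^ Suc j\<close> padded steps is cut into \<open>K\<close> pieces of
  \<open>K ^ j\<close> steps, and one code lists the \<open>K + 1\<close> cut points. They stay
  below \<open>M\<close> because \<open>T\<close> does not leave that range.\<close>

lemma coded_complete:
  assumes codes: "codes n M K" and T: "\<And>a b. T a b \<Longrightarrow> a < M \<and> b < M"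
    and "(a, b) \<in> {(a, b). T a b \<or> a = b} ^^ (K ^ j)" "a < M"
  shows "coded n T j a b"
  using assms(3,4)
proof (induction j arbitrary: a b)
  case 0
  then show ?case by auto
next
  case (Suc j)
  let ?R = "{(a, b). T a b \<or> a = b}"
  have "(a, b) \<in> (?R ^^ (K ^ j)) ^^ K"
    using Suc.prems(1) unfolding relpow_mult[symmetric] by (simp add: mult.commute)
  then obtain f where f: "f 0 = a" "f K = b" "\<And>i. i < K \<Longrightarrow> (f i, f (Suc i)) \<in> ?R ^^ (K ^ j)"
    unfolding relpow_fun_conv by blast
  have bound: "y < M" if "(x, y) \<in> ?R ^^ l" "x < M" for x y l
    using that by (induction l arbitrary: y) (use T in auto)
  have fM: "f i < M" if "i \<le> K" for i
    using that
  proof (induction i)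
    case 0
    then show ?case using f(1) Suc.prems(2) by simp
  next
    case (Suc i)
    then show ?case using bound[OF f(3)[of i]] by simp
  qed
  then obtain w d where wd: "w < n" "d < n" "Suc K < n" "\<And>i. i \<le> K \<Longrightarrow> beta n w d (Suc i) (f i)"
    using spec[OF codes[unfolded codes_def], of f] by auto
  have "coded n T j x y"
    if xy: "1 \<le> l" "l' = Suc l" "l' \<le> Suc K" "beta n w d l x" "beta n w d l' y" for l l' x y
  proof -
    obtain i where i: "l = Suc i" using xy(1) by (cases l) auto
    have "x = f i" "y = f (Suc i)"
      using wd(4)[of i] wd(4)[of "Suc i"] xy i by (auto simp: beta_def)
    then show ?thesis using Suc.IH[OF f(3) fM] xy i by simp
  qed
  then have "\<forall>l<n. \<forall>l'<n. \<forall>x<n. \<forall>y<n. 1 \<le> l \<and> l' = Suc l \<and> l' \<le> Suc K \<and>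
      beta n w d l x \<and> beta n w d l' y \<longrightarrow> coded n T j x y"
    by blast
  moreover have "beta n w d 1 a" "beta n w d (Suc K) b"
    using wd(4)[of 0] wd(4)[of K] f(1,2) by simp_all
  moreover have "1 < n" "1 \<le> Suc K" using wd(3) by simp_all
  ultimately have "\<exists>i<n. \<exists>k<n. i \<le> k \<and> beta n w d i a \<and> beta n w d k b \<and>
     (\<forall>l<n. \<forall>l'<n. \<forall>x<n. \<forall>y<n. i \<le> l \<and> l' = Suc l \<and> l' \<le> k \<and> beta n w d l x \<and> beta n w d l' y
        \<longrightarrow> coded n T j x y)"
    using wd(3) by blast
  then show ?case
    unfolding coded.simps using wd(1,2) by blast
qed

lemma naming_iff:
  "naming n X m \<longleftrightarrow> 0 < m \<and> (\<forall>p<n. \<forall>q<n. X p \<and> X q \<and> p mod m = q mod m \<longrightarrow> p = q)"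
proof
  assume *: "naming n X m"
  show "0 < m \<and> (\<forall>p<n. \<forall>q<n. X p \<and> X q \<and> p mod m = q mod m \<longrightarrow> p = q)"
  proof (intro conjI allI impI)
    show m: "0 < m" using * by (simp add: naming_def)
    fix p q assume "p < n" "q < n" "X p \<and> X q \<and> p mod m = q mod m"
    moreover have "p mod m < n" using \<open>p < n\<close> by (meson le_less_trans mod_less_eq_dividend)
    ultimately show "p = q" using * m unfolding naming_def residue_def by metis
  qed
next
  assume "0 < m \<and> (\<forall>p<n. \<forall>q<n. X p \<and> X q \<and> p mod m = q mod m \<longrightarrow> p = q)"
  then show "naming n X m" unfolding naming_def residue_def by auto
qed

lemma ex_residue:
  assumes "x < n"
  shows "(\<exists>a<n. residue m x a \<and> P a) \<longleftrightarrow> 0 < m \<and> P (x mod m)"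
proof -
  have "x mod m < n" using assms by (meson le_less_trans mod_less_eq_dividend)
  then show ?thesis unfolding residue_def by blast
qed

lemma reach_iff:
  "reach L t n B X Z u v \<longleftrightarrow> walk n (\<lambda>x y. B x y \<or> Z x y) L u v \<or> B u v \<or>
     (\<exists>m<n. naming n X m \<and> (\<exists>x<n. \<exists>y<n. X x \<and> X y \<and> B u x \<and> B y v \<and>
        coded n (link_names n B X Z m) t (x mod m) (y mod m)))"
  unfolding reach_def naming_iff by (simp add: ex_residue cong: conj_cong)

definition union_on :: "nat \<Rightarrow> (nat \<Rightarrow> nat \<Rightarrow> bool) \<Rightarrow> (nat \<Rightarrow> nat \<Rightarrow> bool) \<Rightarrow> (nat \<times> nat) set" where
  "union_on n B Z = {(s, t). s < n \<and> t < n \<and> (B s t \<or> Z s t)}"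

lemma link_union_on:
  assumes "x < n" "y < n" "link n B Z x y"
  shows "(x, y) \<in> (union_on n B Z)\<^sup>*"
proof -
  let ?G = "union_on n B Z"
  consider "B x y" | s t where "s < n" "t < n" "B x s" "Z s t" "B t y"
    using assms(3) unfolding link_def by blast
  then show ?thesis
  proof cases
    case 1
    then show ?thesis using assms by (auto simp: union_on_def)
  next
    case 2
    then have "(x, s) \<in> ?G" "(s, t) \<in> ?G" "(t, y) \<in> ?G" using assms by (auto simp: union_on_def)
    then show ?thesis by (meson rtrancl.simps)
  qed
qed

lemma walk_union_on:
  assumes "walk n (\<lambda>x y. B x y \<or> Z x y) l u v" "u < n" "v < n"
  shows "(u, v) \<in> (union_on n B Z)\<^sup>*"
  using assms
proof (induction l arbitrary: v)
  case (Suc l)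
  then obtain w where "w < n" "walk n (\<lambda>x y. B x y \<or> Z x y) l u w" "B w v \<or> Z w v"
    by auto
  moreover from this have "(w, v) \<in> union_on n B Z"
    using Suc.prems by (auto simp: union_on_def)
  ultimately show ?case using Suc by (meson rtrancl.rtrancl_into_rtrancl)
qed auto

text \<open>Under a checked naming, each name belongs to at most one node of \<open>X\<close>. The
  path of names can thus be followed by actual nodes: consecutive links meet in the same node, not
  merely in nodes of equal name.\<close>

lemma reach_sound:
  assumes "reach L t n B X Z u v" "u < n" "v < n"
  shows "(u, v) \<in> (union_on n B Z)\<^sup>*"
proof -
  let ?G = "union_on n B Z"
  consider "walk n (\<lambda>x y. B x y \<or> Z x y) L u v" | "B u v"
    | m x y where "m < n" "naming n X m" "x < n" "y < n" "X x" "X y" "B u x" "B y v"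
        "coded n (link_names n B X Z m) t (x mod m) (y mod m)"
    using assms(1) unfolding reach_iff by blast
  then show ?thesis
  proof cases
    case 1
    then show ?thesis using walk_union_on assms(2,3) by blast
  next
    case 2
    then show ?thesis using assms(2,3) by (auto simp: union_on_def)
  next
    case 3
    have inj: "p = q" if "p < n" "q < n" "X p" "X q" "p mod m = q mod m" for p q
      using 3(2) that unfolding naming_iff by blast
    have "\<exists>z<n. X z \<and> z mod m = b \<and> (x, z) \<in> ?G\<^sup>*"
      if "(link_names n B X Z m)\<^sup>*\<^sup>* (x mod m) b" for b
      using that
    proof (induction rule: rtranclp_induct)
      case base
      then show ?case using 3 by blast
    next
      case (step b c)
      then obtain z where z: "z < n" "X z" "z mod m = b" "(x, z) \<in> ?G\<^sup>*" by blast
      obtain p q where pq: "p < n" "q < n" "X p" "X q" "link n B Z p q" "p mod m = b" "q mod m = c"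
        using step(2) unfolding link_names_def residue_def by blast
      have "p = z" using inj pq z by simp
      then have "(x, q) \<in> ?G\<^sup>*" using z(4) link_union_on[OF pq(1,2,5)] by simp
      then show ?case using pq by blast
    qed
    from this[OF coded_sound[OF 3(9)]] have "(x, y) \<in> ?G\<^sup>*"
      using inj 3(4,6) by metis
    moreover have "(u, x) \<in> ?G" "(y, v) \<in> ?G"
      using 3 assms(2,3) by (auto simp: union_on_def)
    ultimately show ?thesis by (meson converse_rtrancl_into_rtrancl rtrancl.rtrancl_into_rtrancl)
  qed
qed

text \<open>The formula asks for exactly \<open>L\<close> steps; reflexivity of \<open>B\<close>
  pads a shorter path.\<close>

lemma reach_complete_walk:
  assumes refl: "\<And>x. x < n \<Longrightarrow> B x x" and "n * n \<le> L"
    and "(u, v) \<in> (union_on n B Z)\<^sup>*" "u < n"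
  shows "reach L t n B X Z u v"
proof -
  let ?G = "union_on n B Z" and ?R = "\<lambda>x y. B x y \<or> Z x y"
  have G: "?G \<subseteq> {..<n} \<times> {..<n}" by (auto simp: union_on_def)
  obtain l where l: "l \<le> L" "(u, v) \<in> ?G ^^ l"
    using rtrancl_bounded_relpow[OF G assms(3)] assms(2) le_trans by metis
  have *: "walk n ?R k u x \<and> x < n" if "(u, x) \<in> ?G ^^ k" for k x
    using that
  proof (induction k arbitrary: x)
    case 0
    then show ?case using assms(4) by simp
  next
    case (Suc k)
    then obtain y where y: "(u, y) \<in> ?G ^^ k" "(y, x) \<in> ?G" by auto
    with Suc.IH[OF y(1)] show ?case by (auto simp: union_on_def)
  qed
  have "walk n ?R k u v" if "l \<le> k" for k
    using that
  proof (induction rule: dec_induct)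
    case base
    then show ?case using *[OF l(2)] by simp
  next
    case (step k)
    then show ?case using *[OF l(2)] refl by auto
  qed
  then show ?thesis using l(1) unfolding reach_def by blast
qed

text \<open>Steps within a class of \<open>B\<close> are absorbed by transitivity. Any other step is
  a \<open>Z\<close> edge whose two classes contain nodes of \<open>X\<close>, so it becomes one
  link between named nodes.\<close>

lemma reach_complete_coded:
  assumes refl: "\<And>x. x < n \<Longrightarrow> B x x" and sym: "\<And>x y. B x y \<Longrightarrow> B y x"
    and trans: "\<And>x y z. B x y \<Longrightarrow> B y z \<Longrightarrow> B x z"
    and Z: "\<And>s t. s < n \<Longrightarrow> t < n \<Longrightarrow> Z s t \<Longrightarrow> \<not> B s t \<Longrightarrow>
              (\<exists>x<n. X x \<and> B s x) \<and> (\<exists>y<n. X y \<and> B t y)"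
    and m: "naming n X m" "m \<le> M" and M: "M < n" "M * M \<le> K ^ t" and codes: "codes n M K"
    and "(u, v) \<in> (union_on n B Z)\<^sup>*" "u < n"
  shows "reach L t n B X Z u v"
proof -
  let ?T = "link_names n B X Z m"
  have m0: "0 < m" using m(1) by (simp add: naming_def)
  have *: "B u v \<or> (\<exists>x<n. \<exists>y<n. X x \<and> X y \<and> B u x \<and> B y v \<and> ?T\<^sup>*\<^sup>* (x mod m) (y mod m))"
    using assms(10)
  proof (induction rule: rtrancl_induct)
    case base
    then show ?case using refl assms(11) by simp
  next
    case (step v w)
    have vw: "v < n" "w < n" "B v w \<or> Z v w" using step(2) by (auto simp: union_on_def)
    show ?case
    proof (cases "B v w")
      case True
      then show ?thesis using step.IH trans by blast
    next
      case False
      then have "Z v w" using vw by blast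
      obtain p q where p: "p < n" "X p" "B v p" and q: "q < n" "X q" "B w q"
        using Z[OF vw(1,2) \<open>Z v w\<close> False] by blast
      have T: "?T (y mod m) (q mod m)" if "y < n" "X y" "B y v" for y
        unfolding link_names_def link_def residue_def
        using that q vw \<open>Z v w\<close> m0 by blast
      from step.IH show ?thesis
      proof
        \<comment> \<open>Up to here the path has stayed in the class of \<open>u\<close>; the node
          \<open>p\<close> found in it starts the sequence of named nodes.\<close>
        assume "B u v"
        then have "B u p" "?T\<^sup>*\<^sup>* (p mod m) (q mod m)" using p T sym trans by blast+
        then show ?thesis using p q sym by blast
      next
        assume "\<exists>x<n. \<exists>y<n. X x \<and> X y \<and> B u x \<and> B y v \<and> ?T\<^sup>*\<^sup>* (x mod m) (y mod m)"
        then obtain x y where xy: "x < n" "y < n" "X x" "X y" "B u x" "B y v" "?T\<^sup>*\<^sup>* (x mod m) (y mod m)"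
          by blast
        then have "?T\<^sup>*\<^sup>* (x mod m) (q mod m)" using T by (meson rtranclp.rtrancl_into_rtrancl)
        then show ?thesis using xy q sym by blast
      qed
    qed
  qed
  have TM: "a < M \<and> b < M" if "?T a b" for a b
  proof -
    have "a < m \<and> b < m" using that m0 unfolding link_names_def residue_def by auto
    then show ?thesis using m(2) by simp
  qed
  have "coded n ?T t (x mod m) (y mod m)" if xy: "?T\<^sup>*\<^sup>* (x mod m) (y mod m)" for x y
  proof (rule coded_complete[OF codes TM])
    let ?S = "{(a, b). ?T a b}" and ?R = "{(a, b). ?T a b \<or> a = b}"
    have S: "?S \<subseteq> {..<M} \<times> {..<M}" using TM by auto
    have "(x mod m, y mod m) \<in> ?S\<^sup>*"
      using xy by (simp add: rtrancl_def)
    from rtrancl_bounded_relpow[OF S this]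
    obtain l where l: "l \<le> K ^ t" "(x mod m, y mod m) \<in> ?S ^^ l"
      using M(2) le_trans by metis
    have "(x mod m, y mod m) \<in> ?R ^^ k" if "l \<le> k" for k
      using that
    proof (induction rule: dec_induct)
      case base
      have "?S ^^ l \<subseteq> ?R ^^ l" by (induction l) auto
      then show ?case using l(2) by blast
    next
      case (step k)
      then show ?case by auto
    qed
    then show "(x mod m, y mod m) \<in> ?R ^^ (K ^ t)" using l(1) by blast
    show "x mod m < M" using m0 m(2) by (meson mod_less_divisor order_less_le_trans)
  qed
  with * m M(1) show ?thesis unfolding reach_iff by (meson le_less_trans)
qed

section \<open>Short names and codes\<close>

text \<open>
  Nair's argument: the entries \<open>1 / (m * (n choose m))\<close> of Leibniz's harmonic triangle are integer
  combinations of \<open>1, 1/2, \<dots>, 1/n\<close>.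
\<close>

lemma mult_binomial_dvd:
  assumes "1 \<le> m" "m \<le> n" "\<And>i. 1 \<le> i \<Longrightarrow> i \<le> n \<Longrightarrow> i dvd l"
  shows "m * (n choose m) dvd l"
proof -
  have "real l / real (m * (n choose m)) \<in> \<int>"
    using assms
  proof (induction m arbitrary: n rule: nat_induct_at_least)
    case base
    then obtain q where "l = n * q" by (metis dvdE order_refl)
    then show ?case using base by simp
  next
    case (Suc m)
    then obtain p where p: "n = Suc p" "m \<le> p" by (cases n) auto
    have m: "real m > 0" and pc: "real (p choose m) > 0" and nc: "real (n choose m) > 0"
      using Suc.hyps p by simp_all
    have 1: "real (Suc m) * real (n choose Suc m) = real n * real (p choose m)"
      using Suc_times_binomial[of m p] p by (metis of_nat_mult)
    have "Suc p * (p choose m) = (Suc p - m) * (Suc p choose m)"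
      using binomial_absorb_comp[of "Suc p" m] by simp
    then have "real (Suc p) * real (p choose m) = real (Suc p - m) * real (Suc p choose m)"
      by (simp only: flip: of_nat_mult)
    then have 2: "real n * real (p choose m) = (real n - real m) * real (n choose m)"
      using p(2) by (simp only: p(1) of_nat_diff le_SucI)
    \<comment> \<open>The recurrence of the triangle: an entry of column \<open>Suc m\<close> is a
      difference of two entries of column \<open>m\<close>, to which the induction hypothesis
      applies.\<close>
    have eq: "1 / (real m * real (p choose m)) - 1 / (real m * real (n choose m)) =
        1 / (real n * real (p choose m))"
    proof -
      have *: "1 / (y * s) - 1 / (y * r) = 1 / (x * s)"
        if "0 < x" "0 < y" "0 < s" "0 < r" "x * s = (x - y) * r" for x y r s :: real
      proof -
        have "x * (r - s) = y * r" using that(5) by (simp add: algebra_simps)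
        then have "(r - s) * (x * s) = 1 * (y * r * s)" by (simp add: mult_ac)
        then have "(r - s) / (y * r * s) = 1 / (x * s)"
          using that(1-4) by (subst frac_eq_eq) simp_all
        moreover have "1 / (y * s) - 1 / (y * r) = (r - s) / (y * r * s)"
          using that(2-4) by (simp add: field_simps)
        ultimately show ?thesis by simp
      qed
      show ?thesis using m pc nc 2 p by (intro *) simp_all
    qed
    have "real l / real (Suc m * (n choose Suc m)) = real l * (1 / (real n * real (p choose m)))"
      unfolding of_nat_mult 1 by simp
    also have "\<dots> = real l / real (m * (p choose m)) - real l / real (m * (n choose m))"
      unfolding eq[symmetric] by (simp add: right_diff_distrib)
    also have "\<dots> \<in> \<int>"
      by (intro Ints_diff Suc.IH) (use Suc.prems p in auto)
    finally show ?case .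
  qed
  then obtain z where z: "real l / real (m * (n choose m)) = of_int z" by (rule Ints_cases)
  have "real (m * (n choose m)) > 0" using assms(1,2) by simp
  then have "real l = of_int z * real (m * (n choose m))"
    using z by (metis less_irrefl nonzero_divide_eq_eq)
  then have "of_int (int l) = (of_int (z * int (m * (n choose m))) :: real)" by simp
  then have "int l = z * int (m * (n choose m))" by (simp only: of_int_eq_iff)
  then have "int (m * (n choose m)) dvd int l" by simp
  then show ?thesis by (simp only: int_dvd_int_iff)
qed

text \<open>The number \<open>k * (2 * k choose k)\<close> divides \<open>l\<close>, and the central
  binomial coefficient is at least \<open>4 ^ k / (2 * k)\<close>.\<close>

lemma common_multiple_ge:
  assumes "1 \<le> k" "0 < l" "\<And>i. 1 \<le> i \<Longrightarrow> i \<le> 2 * k \<Longrightarrow> i dvd l"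
  shows "2 ^ k \<le> l"
proof -
  have "4 ^ k / (2 * real k) \<le> real (2 * k choose k)"
    using assms(1) by (intro central_binomial_lower_bound) simp
  then have "4 ^ k \<le> 2 * real (k * (2 * k choose k))"
    using assms(1) by (simp add: field_simps)
  moreover have "2 * 2 ^ k \<le> (2 ^ k * 2 ^ k :: real)"
    using assms(1) by (intro mult_right_mono) (auto intro: self_le_power)
  moreover have "(4 :: real) ^ k = 2 ^ k * 2 ^ k" by (simp flip: power_mult_distrib)
  ultimately have "2 * 2 ^ k \<le> 2 * real (k * (2 * k choose k))" by linarith
  then have "real (2 ^ k) \<le> real (k * (2 * k choose k))" by simp
  then have "2 ^ k \<le> k * (2 * k choose k)" by (simp only: of_nat_le_iff)
  also have "\<dots> \<le> l"
    using mult_binomial_dvd[of k "2 * k" l] assms by (auto intro: dvd_imp_le)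
  finally show ?thesis .
qed

text \<open>If every \<open>i \<le> 2 * k\<close> identified two elements of \<open>X\<close>, the
  product of all differences would be a common multiple of these \<open>i\<close>, hence at least
  \<open>2 ^ k\<close>. But it has at most \<open>N * N\<close> factors, each at most
  \<open>n\<close>.\<close>

lemma ex_injective_mod:
  assumes X: "X \<subseteq> {..<n}" "card X \<le> N" and k: "1 \<le> k" "n ^ (N * N) < 2 ^ k"
  shows "\<exists>m. 1 \<le> m \<and> m \<le> 2 * k \<and> inj_on (\<lambda>x. x mod m) X"
proof (rule ccontr)
  assume no: "\<not> ?thesis"
  have fin: "finite X" using X(1) by (rule finite_subset) simp
  define D where "D = {(x, y) \<in> X \<times> X. x < y}"
  have D: "finite D" "D \<subseteq> X \<times> X" using fin by (auto simp: D_def intro: finite_subset)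
  define l where "l = (\<Prod>p\<in>D. snd p - fst p)"
  have pos: "0 < l" unfolding l_def by (rule prod_pos) (auto simp: D_def)
  have "i dvd l" if "1 \<le> i" "i \<le> 2 * k" for i
  proof -
    have "\<not> inj_on (\<lambda>x. x mod i) X" using no that by blast
    then obtain x y where xy: "x \<in> X" "y \<in> X" "x mod i = y mod i" "x \<noteq> y"
      unfolding inj_on_def by blast
    define a b where "a = min x y" and "b = max x y"
    have "(a, b) \<in> D" "a mod i = b mod i" "a \<le> b"
      using xy by (auto simp: a_def b_def D_def min_def max_def)
    then have "i dvd b - a" by (metis mod_eq_dvd_iff_nat)
    also have "b - a dvd l"
      unfolding l_def using dvd_prodI[OF D(1) \<open>(a, b) \<in> D\<close>, of "\<lambda>p. snd p - fst p"] by simp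
    finally show ?thesis .
  qed
  then have "2 ^ k \<le> l" by (intro common_multiple_ge k pos)
  also have "l \<le> (\<Prod>p\<in>D. n)"
    unfolding l_def by (rule prod_mono) (use X(1) in \<open>force simp: D_def\<close>)
  also have "\<dots> = n ^ card D" by simp
  also have "\<dots> \<le> n ^ (N * N)"
  proof (cases "n = 0")
    case True
    \<comment> \<open>Powers of 0 are not monotone in the exponent, so \<open>n = 0\<close> is
      excluded separately: the modulus 1 is injective on the empty set.\<close>
    then have "X = {}" using X(1) by auto
    then show ?thesis using no k(1) by (auto dest!: spec[of _ 1])
  next
    case False
    have "card D \<le> card (X \<times> X)" using D fin by (intro card_mono) auto
    also have "\<dots> \<le> N * N" using X(2) by (simp add: card_cartesian_product mult_le_mono)
    finally show ?thesis using False by (intro power_increasing) auto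
  qed
  finally show False using k(2) by simp
qed

text \<open>Chinese remaindering. In \<open>d\<close>, the factorial makes the moduli pairwise
  coprime and the factor \<open>M\<close> makes them exceed the entries. The code \<open>w\<close>
  is below their product, which is at most \<open>q K ^ Suc K\<close>.\<close>

lemma codes_if:
  assumes "1 \<le> K" "1 \<le> M" and n: "Suc (Suc K * (M * fact (Suc K))) ^ Suc K \<le> n"
  shows "codes n M K" "M < n"
proof -
  define d where "d = M * fact (Suc K)"
  define q where "q i = Suc (Suc i * d)" for i
  have d: "1 \<le> d" "M \<le> d" using assms(2) fact_ge_1[of "Suc K"] by (simp_all add: d_def del: fact_Suc)
  have "q K < q K ^ 2" using d by (simp add: q_def power2_eq_square)
  also have "\<dots> \<le> q K ^ Suc K" using assms(1) by (intro power_increasing) (simp_all add: q_def)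
  also have qn: "\<dots> \<le> n" using n by (simp only: q_def d_def)
  finally have qKn: "q K < n" .
  have q_mono: "q i \<le> q K" if "i \<le> K" for i
    using that by (simp add: q_def)
  have "d < q K" by (simp add: q_def)
  then show "M < n" using d(2) qKn by linarith
  have cop: "coprime (q i) (q j)" if "i < j" "j \<le> K" for i j
  proof (rule coprimeI)
    fix c assume c: "c dvd q i" "c dvd q j"
    \<comment> \<open>In this combination \<open>d\<close> cancels. What remains divides
      \<open>(K + 1)!\<close>, hence \<open>d\<close>, so \<open>c\<close> divides both
      \<open>q i\<close> and \<open>q i - 1\<close>.\<close>
    have "c dvd Suc j * q i - Suc i * q j" using c by (intro dvd_diff_nat dvd_mult)
    also have "Suc j * q i - Suc i * q j = j - i" by (simp add: q_def algebra_simps)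
    also have "j - i dvd fact (Suc K)" using that by (intro dvd_fact) auto
    also have "fact (Suc K) dvd Suc i * d" unfolding d_def by simp
    finally have "c dvd Suc i * d" .
    then show "is_unit c" using c(1) unfolding q_def by (metis dvd_add_right_iff plus_1_eq_Suc add.commute)
  qed
  show "codes n M K"
    unfolding codes_def
  proof (intro allI impI)
    fix f :: "nat \<Rightarrow> nat" assume f: "\<forall>i\<le>K. f i < M"
    have "\<exists>!x. x < (\<Prod>i\<in>{..K}. q i) \<and> (\<forall>i\<in>{..K}. [x = f i] (mod q i))"
    proof (rule chinese_remainder_unique_nat)
      show "\<forall>i\<in>{..K}. \<forall>j\<in>{..K}. i \<noteq> j \<longrightarrow> coprime (q i) (q j)"
        using cop by (metis atMost_iff coprime_commute linorder_neqE_nat)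
    qed (simp_all add: q_def)
    then obtain w where w: "w < (\<Prod>i\<in>{..K}. q i)" "\<And>i. i \<le> K \<Longrightarrow> [w = f i] (mod q i)"
      by auto
    have "(\<Prod>i\<in>{..K}. q i) \<le> (\<Prod>i\<in>{..K}. q K)"
      by (rule prod_mono) (use q_mono in auto)
    then have "w < n" using w(1) qn by simp
    have "beta n w d (Suc i) (f i)" if "i \<le> K" for i
    proof -
      have "d \<le> Suc i * d" "f i < M" using f that by simp_all
      then have "f i < q i" using d(2) unfolding q_def by linarith
      then have "w mod q i = f i" using w(2)[OF that] by (simp add: cong_def)
      moreover have "q i < n" using q_mono[OF that] qKn by linarith
      ultimately show ?thesis by (simp add: beta_def q_def)
    qed
    moreover have "d < n" using \<open>d < q K\<close> qKn by linarith
    moreover have "Suc K < n"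
    proof -
      have "Suc K * 1 \<le> Suc K * d" using d(1) by (rule mult_le_mono2)
      then have "Suc K < Suc (Suc K * d)" by (simp only: mult_1_right le_imp_less_Suc)
      then show ?thesis using qKn unfolding q_def by (rule less_trans)
    qed
    ultimately show "\<exists>w<n. \<exists>d<n. Suc K < n \<and> (\<forall>i\<le>K. beta n w d (Suc i) (f i))"
      using \<open>w < n\<close> by blast
  qed
qed

section \<open>Parameters for sets of polylogarithmic size\<close>

definition capacity :: "nat \<Rightarrow> nat \<Rightarrow> nat \<Rightarrow> real \<Rightarrow> bool" where
  "capacity L t n s \<longleftrightarrow> n * n \<le> L \<or> (\<exists>M K. M < n \<and> M * M \<le> K ^ t \<and> codes n M K \<and>
     (\<forall>X. X \<subseteq> {..<n} \<and> real (card X) \<le> s \<longrightarrow> (\<exists>m\<le>M. 0 < m \<and> inj_on (\<lambda>x. x mod m) X)))"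

lemma codes_if_large:
  fixes K a M n :: nat
  assumes K: "a + 4 \<le> K" and M: "1 \<le> M" "M \<le> K ^ a" and n: "2 ^ (K ^ 4) \<le> n"
  shows "codes n M K" "M < n"
proof -
  have pow: "Suc K \<le> 2 ^ K" by (meson Suc_leI less_exp)
  have "fact (Suc K) \<le> Suc K ^ Suc K" using fact_le_power[of "Suc K", where 'a = nat] by simp
  also have "\<dots> \<le> (2 ^ K) ^ Suc K" using pow by (rule power_mono) simp
  finally have f: "fact (Suc K) \<le> (2 :: nat) ^ (K * Suc K)" by (simp only: power_mult)
  have "K ^ a \<le> (2 ^ K) ^ a" using pow by (intro power_mono) auto
  then have m: "M \<le> 2 ^ (K * a)" using M(2) by (simp only: power_mult)
  have "Suc K * (M * fact (Suc K)) \<le> 2 ^ K * (2 ^ (K * a) * 2 ^ (K * Suc K))"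
    using pow m f by (intro mult_le_mono)
  also have "\<dots> = 2 ^ (K * (a + K + 2))" by (simp add: algebra_simps flip: power_add)
  finally have "Suc K * (M * fact (Suc K)) \<le> 2 ^ (K * (a + K + 2))" .
  moreover have "1 \<le> (2 :: nat) ^ (K * (a + K + 2))" by simp
  ultimately have "Suc (Suc K * (M * fact (Suc K))) \<le> 2 * 2 ^ (K * (a + K + 2))" by linarith
  also have "\<dots> = 2 ^ (K * (a + K + 2) + 1)" by simp
  also have "\<dots> \<le> 2 ^ (K * (a + K + 3))" using K by (intro power_increasing) (auto simp: algebra_simps)
  finally have "Suc (Suc K * (M * fact (Suc K))) ^ Suc K \<le> (2 ^ (K * (a + K + 3))) ^ Suc K"
    by (rule power_mono) simp
  also have "\<dots> = 2 ^ (K * ((a + K + 3) * Suc K))" by (simp only: mult.assoc flip: power_mult)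
  also have "\<dots> \<le> 2 ^ (K ^ 4)"
  proof (rule power_increasing)
    have "(a + K + 3) * Suc K \<le> (2 * K) * (2 * K)" using K by (intro mult_le_mono) auto
    also have "\<dots> = 4 * (K * K)" by simp
    also have "\<dots> \<le> K * (K * K)" using K by (intro mult_le_mono1) simp
    finally have "K * ((a + K + 3) * Suc K) \<le> K * (K * (K * K))" by (rule mult_le_mono2)
    then show "K * ((a + K + 3) * Suc K) \<le> K ^ 4" by (simp add: eval_nat_numeral)
  qed simp
  finally have "Suc (Suc K * (M * fact (Suc K))) ^ Suc K \<le> n" using n by linarith
  then show "codes n M K" "M < n" using codes_if[of K M n] K M(1) by auto
qed

text \<open>The bound on the set counts two ends for each changed edge and the two ends of one
  further edge that is cut. It is essential that \<open>L\<close> and \<open>t\<close>, which enter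
  the formulas, depend on \<open>c\<close> only.\<close>

lemma ex_capacity: "\<exists>L t. \<forall>n. capacity L t n (2 + 2 * log 2 (real n) ^ c)"
proof -
  \<comment> \<open>With \<open>log n\<close> below \<open>(K + 1) ^ 4\<close>, the modulus is of
    order \<open>log n * N * N\<close>, that is, \<open>(K + 1) ^ (4 + 8 * c)\<close>. One more
    power of \<open>K\<close> absorbs the factor \<open>32 * 2 ^ b\<close>, which explains
    \<open>a\<close> and \<open>K0\<close>.\<close>
  define b where "b = 4 + 8 * c"
  define a where "a = b + 1"
  define K0 :: nat where "K0 = 32 * 2 ^ b"
  have "capacity ((2 ^ (K0 ^ 4)) * 2 ^ (K0 ^ 4)) (2 * a) n (2 + 2 * log 2 (real n) ^ c)" for n
  proof (cases "n < 2 ^ (K0 ^ 4)")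
    case True
    then show ?thesis unfolding capacity_def by (intro disjI1 mult_le_mono) simp_all
  next
    case False
    then have n: "1 \<le> n" by (metis not_less one_le_numeral one_le_power order_trans)
    obtain j where j: "n < 2 ^ (j ^ 4)" "\<And>i. i < j \<Longrightarrow> \<not> n < 2 ^ (i ^ 4)"
    proof -
      have "n \<le> n ^ 4" using n by (intro self_le_power) simp_all
      also have "\<dots> < 2 ^ (n ^ 4)" by (rule less_exp)
      finally show ?thesis using that exists_least_iff[of "\<lambda>j. n < 2 ^ (j ^ 4)"] by blast
    qed
    then obtain K where K: "j = Suc K" using n by (cases j) auto
    have nK: "2 ^ (K ^ 4) \<le> n" "n < 2 ^ (Suc K ^ 4)" using j[unfolded K] by (auto simp: not_less)
    have "K0 \<le> K"
    proof (rule ccontr)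
      assume "\<not> K0 \<le> K"
      then have "Suc K ^ 4 \<le> K0 ^ 4" by (intro power_mono) auto
      then have "(2 :: nat) ^ (Suc K ^ 4) \<le> 2 ^ (K0 ^ 4)" by (intro power_increasing) auto
      then show False using nK(2) False by linarith
    qed
    \<comment> \<open>\<open>N\<close> bounds the size of the set, and \<open>k\<close> is chosen
      such that \<open>n < 2 ^ (Suc K ^ 4)\<close> yields
      \<open>n ^ (N * N) < 2 ^ k\<close>.\<close>
    define N where "N = 4 * Suc K ^ (4 * c)"
    define k where "k = Suc K ^ 4 * (N * N)"
    define M where "M = 2 * k"
    have k1: "1 \<le> k" by (simp add: k_def N_def)
    have b_less: "b < 2 ^ b" by (rule less_exp)
    have K4: "a + 4 \<le> K" using \<open>K0 \<le> K\<close> b_less unfolding K0_def a_def by linarith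
    have "M = 32 * Suc K ^ b"
      by (simp add: M_def k_def N_def b_def power_add mult.commute flip: power_mult power2_eq_square)
    also have "\<dots> \<le> 32 * (2 * K) ^ b" using K4 by (intro mult_le_mono2 power_mono) auto
    also have "\<dots> = K0 * K ^ b" by (simp add: K0_def power_mult_distrib)
    also have "\<dots> \<le> K ^ a" using \<open>K0 \<le> K\<close> by (simp add: a_def)
    finally have MK: "M \<le> K ^ a" .
    have M1: "1 \<le> M" using k1 by (simp add: M_def)
    have "M * M \<le> K ^ a * K ^ a" using MK by (rule mult_le_mono[OF _ MK])
    then have M2: "M * M \<le> K ^ (2 * a)" by (simp add: mult_2 power_add)
    have "\<exists>m\<le>M. 0 < m \<and> inj_on (\<lambda>x. x mod m) X"
      if X: "X \<subseteq> {..<n}" "real (card X) \<le> 2 + 2 * log 2 (real n) ^ c" for X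
    proof -
      have "log 2 (real n) \<le> real (Suc K ^ 4)"
        using log2_of_power_less[OF nK(2)] n by linarith
      moreover have "0 \<le> log 2 (real n)" using n by simp
      ultimately have "log 2 (real n) ^ c \<le> real (Suc K ^ 4) ^ c" by (rule power_mono)
      then have "real (card X) \<le> real (2 + 2 * (Suc K ^ 4) ^ c)" using X(2) by simp
      then have "card X \<le> 2 + 2 * Suc K ^ (4 * c)" by (simp only: of_nat_le_iff power_mult)
      also have "\<dots> \<le> N" using one_le_power[of "Suc K" "4 * c"] by (simp add: N_def)
      finally have XN: "card X \<le> N" .
      have "n ^ (N * N) < (2 ^ (Suc K ^ 4)) ^ (N * N)"
        using nK(2) by (rule power_strict_mono) (simp_all add: N_def)
      then have "n ^ (N * N) < 2 ^ k" by (simp only: k_def power_mult)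
      from ex_injective_mod[OF X(1) XN k1 this] show ?thesis
        unfolding M_def by (auto simp: Suc_le_eq)
    qed
    then show ?thesis
      unfolding capacity_def using codes_if_large[OF K4 M1 MK nK(1)] M2 by blast
  qed
  then show ?thesis by blast
qed

section \<open>Spanning forests\<close>

definition conn :: "graph \<Rightarrow> (nat \<times> nat) set" where
  "conn G = {(x, y). {x, y} \<in> G}\<^sup>*"

text \<open>Acyclicity in the form that every edge is a bridge. As \<open>conn\<close> is reflexive,
  this also excludes loops.\<close>

definition forest :: "graph \<Rightarrow> bool" where
  "forest F \<longleftrightarrow> (\<forall>a b. {a, b} \<in> F \<longrightarrow> (a, b) \<notin> conn (F - {{a, b}}))"

lemma conn_refl [simp]: "(u, u) \<in> conn G"
  by (simp add: conn_def)

lemma conn_sym: "(u, v) \<in> conn G \<Longrightarrow> (v, u) \<in> conn G"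
proof -
  have "sym {(x, y). {x, y} \<in> G}" by (auto simp: sym_def insert_commute)
  then show "(u, v) \<in> conn G \<Longrightarrow> (v, u) \<in> conn G"
    unfolding conn_def using sym_rtrancl symD by metis
qed

lemma conn_trans: "(u, v) \<in> conn G \<Longrightarrow> (v, w) \<in> conn G \<Longrightarrow> (u, w) \<in> conn G"
  unfolding conn_def by (rule rtrancl_trans)

lemma conn_edge: "{u, v} \<in> G \<Longrightarrow> (u, v) \<in> conn G"
  unfolding conn_def by auto

lemma conn_induct [consumes 1, case_names base step]:
  assumes "(u, v) \<in> conn G" "P u" "\<And>v w. (u, v) \<in> conn G \<Longrightarrow> {v, w} \<in> G \<Longrightarrow> P v \<Longrightarrow> P w"
  shows "P v"
  using assms(1) unfolding conn_def
  by (induction rule: rtrancl_induct) (use assms(2,3) in \<open>auto simp: conn_def\<close>)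

lemma conn_subset:
  assumes "\<And>x y. {x, y} \<in> G \<Longrightarrow> (x, y) \<in> conn H"
  shows "conn G \<subseteq> conn H"
proof
  fix p assume "p \<in> conn G"
  then have "(fst p, snd p) \<in> conn G" by simp
  then have "(fst p, snd p) \<in> conn H"
    by (induction rule: conn_induct) (use assms conn_trans conn_refl in blast)+
  then show "p \<in> conn H" by simp
qed

lemma conn_mono: "G \<subseteq> H \<Longrightarrow> conn G \<subseteq> conn H"
  by (rule conn_subset) (auto intro: conn_edge)

lemma conn_empty: "(u, v) \<in> conn {} \<longleftrightarrow> u = v"
  by (simp add: conn_def)

text \<open>A path can be shortened until it uses the inserted edge at most once.\<close>

lemma conn_insertD:
  assumes "(u, v) \<in> conn (insert {a, b} G)"
  shows "(u, v) \<in> conn G \<or> ((u, a) \<in> conn G \<and> (b, v) \<in> conn G) \<or>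
    ((u, b) \<in> conn G \<and> (a, v) \<in> conn G)"
  using assms
proof (induction rule: conn_induct)
  case base
  then show ?case by simp
next
  case (step v w)
  show ?case
  proof (cases "{v, w} \<in> G")
    case True
    then show ?thesis using step.IH conn_edge conn_trans by blast
  next
    case False
    then have "v = a \<and> w = b \<or> v = b \<and> w = a"
      using step.hyps(2) by (auto simp: doubleton_eq_iff)
    then show ?thesis using step.IH conn_refl by metis
  qed
qed

lemma edges_onE:
  assumes "e \<in> F" "F \<subseteq> edges_on n"
  obtains a b where "e = {a, b}" "a < n" "b < n"
  using assms unfolding edges_on_def by blast

lemma edges_on_less:
  assumes "{a, b} \<in> F" "F \<subseteq> edges_on n"
  shows "a < n" "b < n"
  using assms unfolding edges_on_def by (auto simp: doubleton_eq_iff)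

lemma finite_edges_on: "finite (edges_on n)"
  by (rule finite_subset[of _ "Pow {..<n}"]) (auto simp: edges_on_def)

lemma conn_less:
  assumes "(u, v) \<in> conn G" "G \<subseteq> edges_on n" "u < n"
  shows "v < n"
  using assms(1)
proof (induction rule: conn_induct)
  case base
  show ?case by (rule assms(3))
next
  case (step v w)
  show ?case using edges_on_less(2)[OF step.hyps(2) assms(2)] .
qed

text \<open>Edges can be deleted in bulk because separation is decided edge by edge. If
  \<open>u\<close> and \<open>v\<close> were separated only by the last edge \<open>d\<close>, each
  would remain joined to one end of \<open>d\<close>; a connection of \<open>u\<close> and
  \<open>v\<close> avoiding \<open>d\<close> would then join these ends, although \<open>d\<close>
  is a bridge.\<close>

lemma forest_cut:
  assumes F: "forest F" "F \<subseteq> edges_on n" and "finite D" "(u, v) \<in> conn F"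
    and "\<And>e. e \<in> D \<Longrightarrow> (u, v) \<in> conn (F - {e})"
  shows "(u, v) \<in> conn (F - D)"
  using assms(3,5)
proof (induction D rule: finite_induct)
  case empty
  then show ?case using assms(4) by simp
next
  case (insert d D)
  have uv: "(u, v) \<in> conn (F - D)" and d: "(u, v) \<in> conn (F - {d})"
    using insert by simp_all
  show ?case
  proof (cases "d \<in> F")
    case False
    then have "F - insert d D = F - D" by blast
    then show ?thesis using uv by simp
  next
    case True
    then obtain a b where ab: "d = {a, b}" using F(2) by (rule edges_onE)
    let ?H = "F - insert d D"
    have H: "?H \<subseteq> F - {{a, b}}" using ab by blast
    have "F - D = insert {a, b} ?H" using True insert.hyps(2) ab by blast
    then have "(u, v) \<in> conn ?H \<or> ((u, a) \<in> conn ?H \<and> (b, v) \<in> conn ?H) \<or>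
        ((u, b) \<in> conn ?H \<and> (a, v) \<in> conn ?H)"
      using uv conn_insertD by metis
    moreover have "(a, b) \<notin> conn (F - {{a, b}})" using F(1) True ab by (simp add: forest_def)
    ultimately show ?thesis
      using subsetD[OF conn_mono[OF H]] d ab conn_sym conn_trans by metis
  qed
qed

lemma forest_insert:
  assumes G: "forest G" and ab: "(a, b) \<notin> conn G"
  shows "forest (insert {a, b} G)"
  unfolding forest_def
proof (intro allI impI notI)
  fix c d
  assume cd: "{c, d} \<in> insert {a, b} G" "(c, d) \<in> conn (insert {a, b} G - {{c, d}})"
  show False
  proof (cases "{c, d} = {a, b}")
    case True
    then have "insert {a, b} G - {{c, d}} \<subseteq> G" by blast
    then have "(c, d) \<in> conn G" using cd(2) conn_mono by blast
    then show False using ab True conn_sym by (auto simp: doubleton_eq_iff)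
  next
    case False
    let ?H = "G - {{c, d}}"
    have *: "(c, d) \<in> conn G" "(c, d) \<notin> conn ?H"
      using cd(1) False G conn_edge by (auto simp: forest_def)
    have "insert {a, b} G - {{c, d}} = insert {a, b} ?H" using False by blast
    then have "(c, d) \<in> conn ?H \<or> ((c, a) \<in> conn ?H \<and> (b, d) \<in> conn ?H) \<or>
        ((c, b) \<in> conn ?H \<and> (a, d) \<in> conn ?H)"
      using cd(2) conn_insertD by metis
    moreover have "conn ?H \<subseteq> conn G" by (rule conn_mono) blast
    ultimately show False using * ab conn_sym conn_trans by (metis subsetD)
  qed
qed

text \<open>Kruskal's algorithm, started with the edges of \<open>F\<close>.\<close>

definition kruskal :: "graph \<Rightarrow> graph \<Rightarrow> (nat set \<Rightarrow> nat) \<Rightarrow> graph" where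
  "kruskal F E k =
     {{a, b} |a b. {a, b} \<in> E \<and> ({a, b} \<in> F \<or> (a, b) \<notin> conn (F \<union> {e \<in> E. k e < k {a, b}}))}"

lemma kruskal_iff:
  "{x, y} \<in> kruskal F E k \<longleftrightarrow>
     {x, y} \<in> E \<and> ({x, y} \<in> F \<or> (x, y) \<notin> conn (F \<union> {e \<in> E. k e < k {x, y}}))"
proof
  assume "{x, y} \<in> kruskal F E k"
  then obtain a b where ab: "{x, y} = {a, b}" "{a, b} \<in> E"
    "{a, b} \<in> F \<or> (a, b) \<notin> conn (F \<union> {e \<in> E. k e < k {a, b}})"
    unfolding kruskal_def by blast
  then have "(x, y) = (a, b) \<or> (x, y) = (b, a)" by (auto simp: doubleton_eq_iff)
  then show "{x, y} \<in> E \<and> ({x, y} \<in> F \<or> (x, y) \<notin> conn (F \<union> {e \<in> E. k e < k {x, y}}))"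
    using ab(2,3) conn_sym unfolding ab(1) by blast
qed (auto simp: kruskal_def)

lemma kruskal_subset: "kruskal F E k \<subseteq> E"
  unfolding kruskal_def by blast

text \<open>Induction on the weight: a rejected edge is bridged by \<open>F\<close> and lighter
  edges, whose ends are connected in the result by induction.\<close>

lemma conn_kruskal:
  assumes "F \<subseteq> E"
  shows "conn (kruskal F E k) = conn E"
proof
  let ?K = "kruskal F E k"
  show "conn ?K \<subseteq> conn E" by (rule conn_mono) (rule kruskal_subset)
  have "(a, b) \<in> conn ?K" if "{a, b} \<in> E" for a b
    using that
  proof (induction "k {a, b}" arbitrary: a b rule: less_induct)
    case less
    show ?case
    proof (cases "{a, b} \<in> ?K")
      case True
      then show ?thesis by (rule conn_edge)
    next
      case False
      then have "(a, b) \<in> conn (F \<union> {e \<in> E. k e < k {a, b}})"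
        using less.prems by (simp add: kruskal_iff)
      moreover have "conn (F \<union> {e \<in> E. k e < k {a, b}}) \<subseteq> conn ?K"
      proof (rule conn_subset)
        fix x y assume "{x, y} \<in> F \<union> {e \<in> E. k e < k {a, b}}"
        then consider "{x, y} \<in> F" | "{x, y} \<in> E" "k {x, y} < k {a, b}" by blast
        then show "(x, y) \<in> conn ?K"
        proof cases
          case 1
          then have "{x, y} \<in> ?K" using assms by (auto simp: kruskal_iff)
          then show ?thesis by (rule conn_edge)
        next
          case 2
          then show ?thesis using less.hyps by blast
        qed
      qed
      ultimately show ?thesis by blast
    qed
  qed
  then show "conn E \<subseteq> conn ?K" by (rule conn_subset)
qed

text \<open>The new edges are added by increasing weight, each joining two components. Injectivity
  makes all edges added before strictly lighter, so the selection condition speaks about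
  them.\<close>

lemma forest_kruskal:
  assumes "forest F" "F \<subseteq> E" "E \<subseteq> edges_on n" "inj_on k E"
  shows "forest (kruskal F E k)"
proof -
  let ?K = "kruskal F E k"
  have *: "forest (F \<union> S)" if "finite S" "S \<subseteq> ?K - F" for S
    using that
  proof (induction S rule: finite_ranking_induct[where f = k])
    case empty
    then show ?case using assms(1) by simp
  next
    case (insert x S)
    show ?case
    proof (cases "x \<in> S")
      case True
      then show ?thesis using insert by (simp add: insert_absorb)
    next
      case False
      have x: "x \<in> ?K" "x \<notin> F" using insert.prems by auto
      then obtain a b where ab: "x = {a, b}" unfolding kruskal_def by blast
      have "S \<subseteq> {e \<in> E. k e < k {a, b}}"
      proof
        fix y assume y: "y \<in> S"
        have "y \<in> E" "x \<in> E" using y x(1) insert.prems kruskal_subset[of F E k] by blast+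
        moreover have "k y \<noteq> k x"
          using inj_on_eq_iff[OF assms(4) \<open>y \<in> E\<close> \<open>x \<in> E\<close>] y False by blast
        ultimately show "y \<in> {e \<in> E. k e < k {a, b}}"
          using insert.hyps(2)[OF y] ab by auto
      qed
      then have "conn (F \<union> S) \<subseteq> conn (F \<union> {e \<in> E. k e < k {a, b}})"
        by (intro conn_mono) blast
      moreover have "(a, b) \<notin> conn (F \<union> {e \<in> E. k e < k {a, b}})"
        using x ab by (simp add: kruskal_iff)
      ultimately have "(a, b) \<notin> conn (F \<union> S)" by blast
      moreover have "forest (F \<union> S)" using insert by simp
      ultimately show ?thesis using forest_insert ab by simp
    qed
  qed
  have "finite (?K - F)"
    using kruskal_subset assms(3) finite_edges_on by (meson finite_Diff finite_subset)
  from *[OF this] have "forest (F \<union> (?K - F))" by blast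
  moreover have "F \<subseteq> ?K"
  proof
    fix e assume e: "e \<in> F"
    then obtain a b where "e = {a, b}" using assms(2,3) by (meson edges_onE order_trans)
    then show "e \<in> ?K" using e assms(2) by (auto simp: kruskal_iff)
  qed
  ultimately show ?thesis by (simp add: Un_absorb1)
qed

section \<open>The update formulas\<close>

text \<open>
  In the following definitions \<open>E\<close> is the changed graph, and \<open>P a b u v\<close> states that \<open>{a, b}\<close> is an
  edge on the path from \<open>u\<close> to \<open>v\<close> in the old spanning forest \<open>F\<close>.
\<close>

definition old_conn :: "nat \<Rightarrow> (nat \<Rightarrow> nat \<Rightarrow> nat \<Rightarrow> nat \<Rightarrow> bool) \<Rightarrow> nat \<Rightarrow> nat \<Rightarrow> bool" where
  "old_conn n P u v \<longleftrightarrow> u = v \<or> (\<exists>a<n. \<exists>b<n. P a b u v)"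

text \<open>Connectivity in \<open>F \<inter> E - {{x, y}}\<close>.\<close>

definition base ::
    "nat \<Rightarrow> graph \<Rightarrow> (nat \<Rightarrow> nat \<Rightarrow> nat \<Rightarrow> nat \<Rightarrow> bool) \<Rightarrow> nat \<Rightarrow> nat \<Rightarrow> nat \<Rightarrow> nat \<Rightarrow> bool" where
  "base n E P x y u v \<longleftrightarrow> old_conn n P u v \<and>
     (\<forall>a<n. \<forall>b<n. P a b u v \<longrightarrow> {a, b} \<in> E \<and> \<not> (a = x \<and> b = y) \<and> \<not> (a = y \<and> b = x))"

text \<open>\<open>P z t z t\<close> says that \<open>{z, t}\<close> is an edge of \<open>F\<close>.
  An edge of \<open>E\<close> between components of \<open>F\<close> must be new, since
  \<open>F\<close> spans the old graph. So the change itself, which formulas do not see, can be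
  recovered as far as needed.\<close>

definition touched ::
    "nat \<Rightarrow> graph \<Rightarrow> (nat \<Rightarrow> nat \<Rightarrow> nat \<Rightarrow> nat \<Rightarrow> bool) \<Rightarrow> nat \<Rightarrow> nat \<Rightarrow> nat \<Rightarrow> bool" where
  "touched n E P x y z \<longleftrightarrow> z = x \<or> z = y \<or>
     (\<exists>t<n. (P z t z t \<and> {z, t} \<notin> E) \<or> ({z, t} \<in> E \<and> \<not> old_conn n P z t))"

text \<open>The lexicographic order of edges by smaller and then larger end, spelled out by
  comparisons; \<open>key\<close> is its numerical form.\<close>

definition pair_less :: "nat \<Rightarrow> nat \<Rightarrow> nat \<Rightarrow> nat \<Rightarrow> bool" where
  "pair_less s t x y \<longleftrightarrow> ((s < x \<and> s < y) \<or> (t < x \<and> t < y)) \<or>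
     \<not> ((x < s \<and> x < t) \<or> (y < s \<and> y < t)) \<and> ((s < x \<and> t < x) \<or> (s < y \<and> t < y))"

text \<open>Nothing is to be cut here: the loop at \<open>u\<close> serves as a dummy, as a forest
  contains no loops. It merely adds \<open>u\<close> to the touched nodes.\<close>

definition new_conn ::
    "nat \<Rightarrow> nat \<Rightarrow> nat \<Rightarrow> graph \<Rightarrow> (nat \<Rightarrow> nat \<Rightarrow> nat \<Rightarrow> nat \<Rightarrow> bool) \<Rightarrow> nat \<Rightarrow> nat \<Rightarrow> bool" where
  "new_conn L t n E P u v \<longleftrightarrow>
     reach L t n (base n E P u u) (touched n E P u u) (\<lambda>a b. {a, b} \<in> E) u v"

definition new_tree ::
    "nat \<Rightarrow> nat \<Rightarrow> nat \<Rightarrow> graph \<Rightarrow> (nat \<Rightarrow> nat \<Rightarrow> nat \<Rightarrow> nat \<Rightarrow> bool) \<Rightarrow> nat \<Rightarrow> nat \<Rightarrow> bool" where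
  "new_tree L t n E P x y \<longleftrightarrow> {x, y} \<in> E \<and> (P x y x y \<or>
     \<not> reach L t n (base n E P x x) (touched n E P x x)
          (\<lambda>a b. {a, b} \<in> E \<and> pair_less a b x y) x y)"

text \<open>The old edges must be cut at \<open>{x, y}\<close> as well, which is why
  \<open>base\<close> and \<open>touched\<close> carry two extra arguments. The steps allowed in
  addition are the other edges of the new forest.\<close>

definition new_path ::
    "nat \<Rightarrow> nat \<Rightarrow> nat \<Rightarrow> graph \<Rightarrow> (nat \<Rightarrow> nat \<Rightarrow> nat \<Rightarrow> nat \<Rightarrow> bool) \<Rightarrow> nat \<Rightarrow> nat \<Rightarrow> nat \<Rightarrow> nat \<Rightarrow> bool"
  where
  "new_path L t n E P x y u v \<longleftrightarrow> new_tree L t n E P x y \<and> new_conn L t n E P u v \<and>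
     \<not> reach L t n (base n E P x y) (touched n E P x y)
          (\<lambda>a b. new_tree L t n E P a b \<and> \<not> (a = x \<and> b = y) \<and> \<not> (a = y \<and> b = x)) u v"

abbreviation aux0 :: "struct \<Rightarrow> nat \<Rightarrow> nat \<Rightarrow> nat \<Rightarrow> nat \<Rightarrow> bool" where
  "aux0 S a b u v \<equiv> [a, b, u, v] \<in> snd (snd S) 0"

lemma fo_old_conn:
  assumes "u \<in> set xs" "v \<in> set xs"
  shows "fo xs (\<lambda>S e. old_conn (fst S) (aux0 S) (u e) (v e))"
  unfolding old_conn_def by (intro fo_intros assms in_lift)

lemma fo2_base:
  assumes "x \<in> set xs" "y \<in> set xs"
  shows "fo2 xs (\<lambda>S e. base (fst S) (fst (snd S)) (aux0 S) (x e) (y e))"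
  unfolding fo2_def base_def by (intro fo_old_conn fo_intros assms in_lift)

lemma fo1_touched:
  assumes "x \<in> set xs" "y \<in> set xs"
  shows "fo1 xs (\<lambda>S e. touched (fst S) (fst (snd S)) (aux0 S) (x e) (y e))"
  unfolding fo1_def touched_def by (intro fo_old_conn fo_intros assms in_lift)

lemma fo_new_conn:
  assumes "u \<in> set xs" "v \<in> set xs"
  shows "fo xs (\<lambda>S e. new_conn L t (fst S) (fst (snd S)) (aux0 S) (u e) (v e))"
  unfolding new_conn_def
proof (intro fo_reach fo2_base fo1_touched assms)
  show "fo2 xs (\<lambda>S e a b. {a, b} \<in> fst (snd S))"
    unfolding fo2_def by (intro fo_intros in_lift)
qed

lemma fo_new_tree:
  assumes "x \<in> set xs" "y \<in> set xs"
  shows "fo xs (\<lambda>S e. new_tree L t (fst S) (fst (snd S)) (aux0 S) (x e) (y e))"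
  unfolding new_tree_def
proof (intro fo_conj fo_or fo_not fo_edge fo_aux fo_reach fo2_base fo1_touched assms)
  show "fo2 xs (\<lambda>S e a b. {a, b} \<in> fst (snd S) \<and> pair_less a b (x e) (y e))"
    unfolding fo2_def pair_less_def by (intro fo_intros assms in_lift)
qed

lemma fo_new_path:
  assumes "x \<in> set xs" "y \<in> set xs" "u \<in> set xs" "v \<in> set xs"
  shows "fo xs (\<lambda>S e. new_path L t (fst S) (fst (snd S)) (aux0 S) (x e) (y e) (u e) (v e))"
  unfolding new_path_def
proof (intro fo_conj fo_not fo_new_tree fo_new_conn fo_reach fo2_base fo1_touched assms)
  show "fo2 xs (\<lambda>S e a b. new_tree L t (fst S) (fst (snd S)) (aux0 S) a b \<and>
      \<not> (a = x e \<and> b = y e) \<and> \<not> (a = y e \<and> b = x e))"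
    unfolding fo2_def by (intro fo_new_tree fo_intros assms in_lift)
qed

lemma ex_formula:
  assumes "fo (map (\<lambda>i ts. ts ! i) [0..<k]) \<Phi>"
  obtains \<phi> where "wf_formula [4, 2] \<phi>" "free_vars \<phi> \<subseteq> {..<k}"
    "\<And>n E A. defined_relation n (interp n E A) k \<phi> =
       {ts. length ts = k \<and> set ts \<subseteq> {..<n} \<and> \<Phi> (n, E, A) ts}"
proof -
  obtain \<phi> where \<phi>: "expresses \<phi> (map (\<lambda>i ts. ts ! i) [0..<k]) \<Phi>"
    using assms unfolding fo_def ..
  have fv: "free_vars \<phi> \<subseteq> {..<k}" using expressesD(2)[OF \<phi>] by simp
  have "holds {..<n} (interp n E A) (\<lambda>j. ts ! j) \<phi> \<longleftrightarrow> \<Phi> (n, E, A) ts"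
    if ts: "length ts = k" "set ts \<subseteq> {..<n}" for n E A ts
  proof -
    have "holds {..<n} (interp n E A) (\<lambda>j. ts ! j) \<phi> \<longleftrightarrow>
        holds {..<n} (interp n E A) (\<lambda>j. (map (\<lambda>i ts. ts ! i) [0..<k] ! j) ts) \<phi>"
    proof (rule holds_cong)
      fix j assume "j \<in> free_vars \<phi>"
      then have "j < k" using fv by auto
      then show "ts ! j = (map (\<lambda>i ts. ts ! i) [0..<k] ! j) ts" by simp
    qed
    also have "\<dots> \<longleftrightarrow> \<Phi> (n, E, A) ts"
    proof (rule expressesD(3)[OF \<phi>])
      fix x :: "nat list \<Rightarrow> nat" assume "x \<in> set (map (\<lambda>i ts. ts ! i) [0..<k])"
      then obtain i where "i < k" "x = (\<lambda>ts. ts ! i)" by auto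
      then have "x ts \<in> set ts" using ts(1) by simp
      then show "x ts < n" using ts(2) by auto
    qed
    finally show ?thesis .
  qed
  then have "defined_relation n (interp n E A) k \<phi> =
       {ts. length ts = k \<and> set ts \<subseteq> {..<n} \<and> \<Phi> (n, E, A) ts}" for n E A
    unfolding defined_relation_def by blast
  then show thesis using that expressesD(1)[OF \<phi>] fv by blast
qed

lemma ex_program:
  obtains \<phi> \<psi> where "wf_program (Program [(4, \<phi>), (2, \<psi>)] 1)"
    "\<And>n E A. defined_relation n (interp n E A) 4 \<phi> = {[x, y, u, v] |x y u v.
       x < n \<and> y < n \<and> u < n \<and> v < n \<and> new_path L t n E (\<lambda>a b u v. [a, b, u, v] \<in> A 0) x y u v}"
    "\<And>n E A. defined_relation n (interp n E A) 2 \<psi> = {[u, v] |u v.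
       u < n \<and> v < n \<and> new_conn L t n E (\<lambda>a b u v. [a, b, u, v] \<in> A 0) u v}"
proof -
  have mem: "(\<lambda>ts. ts ! i) \<in> set (map (\<lambda>i ts. ts ! i) [0..<k])" if "i < k" for i k
    using that by auto
  obtain \<phi> where \<phi>: "wf_formula [4, 2] \<phi>" "free_vars \<phi> \<subseteq> {..<4}"
    "\<And>n E A. defined_relation n (interp n E A) 4 \<phi> =
       {ts. length ts = 4 \<and> set ts \<subseteq> {..<n} \<and>
         new_path L t n E (aux0 (n, E, A)) (ts ! 0) (ts ! 1) (ts ! 2) (ts ! 3)}"
    using fo_new_path[OF mem[of 0 4] mem[of 1 4] mem[of 2 4] mem[of 3 4], of L t]
    by (auto elim: ex_formula)
  obtain \<psi> where \<psi>: "wf_formula [4, 2] \<psi>" "free_vars \<psi> \<subseteq> {..<2}"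
    "\<And>n E A. defined_relation n (interp n E A) 2 \<psi> =
       {ts. length ts = 2 \<and> set ts \<subseteq> {..<n} \<and> new_conn L t n E (aux0 (n, E, A)) (ts ! 0) (ts ! 1)}"
    using fo_new_conn[OF mem[of 0 2] mem[of 1 2], of L t] by (auto elim: ex_formula)
  show thesis
  proof (rule that[of \<phi> \<psi>])
    show "wf_program (Program [(4, \<phi>), (2, \<psi>)] 1)"
      using \<phi>(1,2) \<psi>(1,2) by (simp add: wf_program_def)
    fix n E A
    have 4: "length ts = 4 \<longleftrightarrow> (\<exists>x y u v. ts = [x, y, u, v])" for ts :: "nat list"
      by (auto simp: numeral_eq_Suc length_Suc_conv)
    show "defined_relation n (interp n E A) 4 \<phi> = {[x, y, u, v] |x y u v.
       x < n \<and> y < n \<and> u < n \<and> v < n \<and> new_path L t n E (\<lambda>a b u v. [a, b, u, v] \<in> A 0) x y u v}"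
      unfolding \<phi>(3) 4 by auto
    have 2: "length ts = 2 \<longleftrightarrow> (\<exists>u v. ts = [u, v])" for ts :: "nat list"
      by (auto simp: numeral_eq_Suc length_Suc_conv)
    show "defined_relation n (interp n E A) 2 \<psi> = {[u, v] |u v.
       u < n \<and> v < n \<and> new_conn L t n E (\<lambda>a b u v. [a, b, u, v] \<in> A 0) u v}"
      unfolding \<psi>(3) 2 by auto
  qed
qed

section \<open>Correctness\<close>

definition key :: "nat \<Rightarrow> nat set \<Rightarrow> nat" where
  "key n e = Min e * n + Max e"

lemma lex_less:
  assumes "q < n" "q' < (n :: nat)"
  shows "p * n + q < p' * n + q' \<longleftrightarrow> p < p' \<or> p = p' \<and> q < q'"
proof -
  have *: "r * n + a < r' * n + b" if "r < r'" "a < n" for r r' a b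
  proof -
    have "Suc r * n \<le> r' * n" using that(1) by (intro mult_le_mono1) simp
    then show ?thesis using that(2) by simp
  qed
  show ?thesis
    using *[of p p' q q'] *[of p' p q' q] assms by (cases p p' rule: linorder_cases) auto
qed

lemma key_less:
  assumes "a < n" "b < n" "x < n" "y < n"
  shows "key n {a, b} < key n {x, y} \<longleftrightarrow> pair_less a b x y"
proof -
  have "key n {a, b} < key n {x, y} \<longleftrightarrow>
      min a b < min x y \<or> min a b = min x y \<and> max a b < max x y"
    unfolding key_def using assms by (simp add: lex_less)
  then show ?thesis unfolding pair_less_def by (auto simp: min_def max_def)
qed

lemma inj_on_key: "inj_on (key n) (edges_on n)"
proof (rule inj_onI)
  fix e f assume "e \<in> edges_on n" "f \<in> edges_on n" and eq: "key n e = key n f"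
  then obtain a b x y where e: "e = {a, b}" "a < n" "b < n" and f: "f = {x, y}" "x < n" "y < n"
    unfolding edges_on_def by blast
  have "min a b * n + max a b = min x y * n + max x y"
    using eq e f by (simp add: key_def)
  then have "min a b = min x y" "max a b = max x y"
    using lex_less[of "max a b" n "max x y" "min a b" "min x y"]
      lex_less[of "max x y" n "max a b" "min x y" "min a b"] e f by auto
  then show "e = f" unfolding e f by (auto simp: min_def max_def split: if_splits)
qed

section \<open>Correctness of a single update\<close>

locale forest_update =
  fixes n L t :: nat and F E :: graph and P :: "nat \<Rightarrow> nat \<Rightarrow> nat \<Rightarrow> nat \<Rightarrow> bool" and s :: real
  assumes forest: "forest F" "F \<subseteq> edges_on n" and E: "E \<subseteq> edges_on n"
    and P: "\<And>a b u v. P a b u v \<longleftrightarrow>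
      {a, b} \<in> F \<and> (u, v) \<in> conn F \<and> (u, v) \<notin> conn (F - {{a, b}})"
    and capacity: "capacity L t n s"
    and few_changes:
      "real (card {z. z < n \<and> (\<exists>w. {z, w} \<in> F - E \<or> {z, w} \<in> E \<and> (z, w) \<notin> conn F)}) + 2 \<le> s"
begin

definition H :: "nat \<Rightarrow> nat \<Rightarrow> graph" where
  "H x y = F \<inter> E - {{x, y}}"

lemma finite_F: "finite F"
  using forest(2) finite_edges_on by (rule finite_subset)

lemma P_edge: "P x y x y \<longleftrightarrow> {x, y} \<in> F"
  unfolding P using forest(1) by (auto simp: forest_def intro: conn_edge)

lemma no_loop: "{x, x} \<notin> F"
  using forest(1) conn_refl unfolding forest_def by blast

lemma cut:
  assumes "D \<subseteq> F" "(u, v) \<in> conn F" "\<And>a b. {a, b} \<in> D \<Longrightarrow> \<not> P a b u v"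
  shows "(u, v) \<in> conn (F - D)"
proof (rule forest_cut[OF forest])
  show "finite D" using assms(1) finite_F by (rule finite_subset)
  show "(u, v) \<in> conn (F - {e})" if e: "e \<in> D" for e
  proof -
    obtain a b where ab: "e = {a, b}"
      using edges_onE[of e F n] e assms(1) forest(2) by blast
    then show ?thesis using assms(3)[of a b] assms(1,2) e unfolding P by auto
  qed
qed (rule assms(2))

text \<open>If no edge of \<open>F\<close> lies on the path, all of \<open>F\<close> can be cut
  without separating the nodes, so they are equal.\<close>

lemma old_conn_iff: "old_conn n P u v \<longleftrightarrow> (u, v) \<in> conn F"
proof
  assume "old_conn n P u v"
  then show "(u, v) \<in> conn F" unfolding old_conn_def P by auto
next
  assume uv: "(u, v) \<in> conn F"
  show "old_conn n P u v"
  proof (rule ccontr)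
    assume *: "\<not> old_conn n P u v"
    have "\<not> P a b u v" if "{a, b} \<in> F" for a b
      using * edges_on_less[OF that forest(2)] unfolding old_conn_def by blast
    then have "(u, v) \<in> conn (F - F)" using uv by (intro cut) auto
    then show False using * by (simp add: conn_empty old_conn_def)
  qed
qed

lemma base_iff: "base n E P x y u v \<longleftrightarrow> (u, v) \<in> conn (H x y)"
proof
  assume *: "base n E P x y u v"
  let ?D = "{e \<in> F. e \<notin> E \<or> e = {x, y}}"
  have "(u, v) \<in> conn (F - ?D)"
  proof (rule cut)
    show "(u, v) \<in> conn F" using * by (simp add: base_def old_conn_iff)
    show "\<not> P a b u v" if "{a, b} \<in> ?D" for a b
    proof -
      have "{a, b} \<in> F" "{a, b} \<notin> E \<or> {a, b} = {x, y}" using that by auto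
      moreover from this have "a < n" "b < n" using edges_on_less forest(2) by blast+
      ultimately show ?thesis using * unfolding base_def by (auto simp: doubleton_eq_iff)
    qed
  qed auto
  moreover have "F - ?D = H x y" unfolding H_def by blast
  ultimately show "(u, v) \<in> conn (H x y)" by simp
next
  assume *: "(u, v) \<in> conn (H x y)"
  have "H x y \<subseteq> F" unfolding H_def by blast
  then have "(u, v) \<in> conn F" using * conn_mono by blast
  moreover have "{a, b} \<in> E \<and> {a, b} \<noteq> {x, y}" if "P a b u v" for a b
  proof (rule ccontr)
    assume "\<not> ({a, b} \<in> E \<and> {a, b} \<noteq> {x, y})"
    then have "H x y \<subseteq> F - {{a, b}}" unfolding H_def by blast
    then show False using * conn_mono that unfolding P by blast
  qed
  ultimately show "base n E P x y u v"
    unfolding base_def old_conn_iff by (auto simp: doubleton_eq_iff)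
qed

lemma touchedI:
  assumes "{z, w} \<in> F - E \<or> {z, w} \<in> E \<and> (z, w) \<notin> conn F"
  shows "touched n E P x y z"
proof -
  have "w < n" using assms edges_on_less(2) forest(2) E by blast
  then show ?thesis using assms unfolding touched_def P_edge old_conn_iff by blast
qed

lemma card_touched: "real (card {z. z < n \<and> touched n E P x y z}) \<le> s"
proof -
  let ?T = "{z. z < n \<and> (\<exists>w. {z, w} \<in> F - E \<or> {z, w} \<in> E \<and> (z, w) \<notin> conn F)}"
  have "{z. z < n \<and> touched n E P x y z} \<subseteq> insert x (insert y ?T)"
    unfolding touched_def P_edge old_conn_iff by blast
  then have "card {z. z < n \<and> touched n E P x y z} \<le> card (insert x (insert y ?T))"
    by (intro card_mono) simp_all
  also have "\<dots> \<le> card ?T + 2"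
    by (simp add: card_insert_if)
  finally show ?thesis using few_changes by linarith
qed

text \<open>
  An untouched component of \<open>H x y\<close> is a component of \<open>F\<close>, and no edge of \<open>E\<close> leaves it.
\<close>

lemma touched_if_leaving:
  assumes "u < n" "{u, v} \<in> E" "(u, v) \<notin> conn (H x y)"
  shows "\<exists>z<n. touched n E P x y z \<and> (u, z) \<in> conn (H x y)"
proof (rule ccontr)
  assume *: "\<not> ?thesis"
  have H: "H x y \<subseteq> edges_on n" using forest(2) unfolding H_def by blast
  have untouched: "\<not> touched n E P x y z" if "(u, z) \<in> conn (H x y)" for z
    using * conn_less[OF that H assms(1)] that by blast
  \<comment> \<open>Otherwise the edge itself would make \<open>u\<close> touched. The path in
    \<open>F\<close> then survives edge by edge, since no node reached on it is touched.\<close>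
  have "(u, v) \<in> conn F"
    using touchedI[of u v x y] untouched[of u] assms(2) by auto
  then have "(u, v) \<in> conn (H x y)"
  proof (induction rule: conn_induct)
    case base
    then show ?case by simp
  next
    case (step z w)
    have "{z, w} \<in> E" using touchedI[of z w x y] untouched[OF step.IH] step.hyps(2) by auto
    moreover have "z \<noteq> x" "z \<noteq> y" using untouched[OF step.IH] by (auto simp: touched_def)
    ultimately have "{z, w} \<in> H x y" using step.hyps(2) by (auto simp: H_def doubleton_eq_iff)
    then show ?case using step.IH conn_edge conn_trans by blast
  qed
  then show False using assms(3) by simp
qed

text \<open>The graph \<open>W\<close> is arbitrary within \<open>E\<close>: all of \<open>E\<close>
  for connectivity, the smaller edges for Kruskal's test, and the new forest without an edge for its
  paths.\<close>

lemma reach_iff_conn: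
  assumes Z: "\<And>a b. a < n \<Longrightarrow> b < n \<Longrightarrow> Z a b \<longleftrightarrow> {a, b} \<in> W" and "W \<subseteq> E"
    and "u < n" "v < n"
  shows "reach L t n (base n E P x y) (touched n E P x y) Z u v \<longleftrightarrow> (u, v) \<in> conn (H x y \<union> W)"
proof -
  let ?B = "base n E P x y" and ?X = "touched n E P x y" and ?G = "H x y \<union> W"
  have G: "?G \<subseteq> edges_on n" using forest(2) assms(2) E unfolding H_def by blast
  have HG: "conn (H x y) \<subseteq> conn ?G" by (rule conn_mono) blast
  have union: "(u, v) \<in> (union_on n ?B Z)\<^sup>* \<longleftrightarrow> (u, v) \<in> conn ?G"
  proof
    assume "(u, v) \<in> (union_on n ?B Z)\<^sup>*"
    then show "(u, v) \<in> conn ?G"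
    proof (induction rule: rtrancl_induct)
      case (step a b)
      then have "(a, b) \<in> conn (H x y) \<or> {a, b} \<in> W" using Z by (auto simp: union_on_def base_iff)
      then have "(a, b) \<in> conn ?G" using HG conn_edge[of a b ?G] by blast
      then show ?case using step.IH conn_trans by blast
    qed simp
  next
    assume "(u, v) \<in> conn ?G"
    then show "(u, v) \<in> (union_on n ?B Z)\<^sup>*"
    proof (induction rule: conn_induct)
      case (step a b)
      have "a < n" "b < n" using edges_on_less[OF step.hyps(2) G] .
      then have "(a, b) \<in> union_on n ?B Z"
        using step.hyps(2) Z conn_edge[of a b "H x y"] by (auto simp: union_on_def base_iff)
      then show ?case using step.IH by (rule rtrancl_into_rtrancl[rotated])
    qed simp
  qed
  have "reach L t n ?B ?X Z u v" if uv: "(u, v) \<in> (union_on n ?B Z)\<^sup>*"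
  proof (cases "n * n \<le> L")
    case True
    show ?thesis by (rule reach_complete_walk[OF _ True uv assms(3)]) (simp add: base_iff)
  next
    case False
    then obtain M K where M: "M < n" "M * M \<le> K ^ t" "codes n M K"
      and names: "\<And>X. X \<subseteq> {..<n} \<Longrightarrow> real (card X) \<le> s \<Longrightarrow>
        \<exists>m\<le>M. 0 < m \<and> inj_on (\<lambda>x. x mod m) X"
      using capacity unfolding capacity_def by blast
    have "\<exists>m\<le>M. 0 < m \<and> inj_on (\<lambda>x. x mod m) {z. z < n \<and> ?X z}"
      by (rule names) (use card_touched in auto)
    then obtain m where m: "m \<le> M" "0 < m" "inj_on (\<lambda>x. x mod m) {z. z < n \<and> ?X z}"
      by blast
    have "naming n ?X m"
      unfolding naming_iff using m(2) inj_onD[OF m(3)] by blast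
    from this m(1) M show ?thesis
    proof (rule reach_complete_coded[rotated 4])
      fix a b assume ab: "a < n" "b < n" "Z a b" "\<not> ?B a b"
      then have "{a, b} \<in> E" "{b, a} \<in> E" using Z assms(2) by (auto simp: insert_commute)
      moreover have "(a, b) \<notin> conn (H x y)" "(b, a) \<notin> conn (H x y)"
        using ab(4) conn_sym by (auto simp: base_iff)
      ultimately show "(\<exists>z<n. ?X z \<and> ?B a z) \<and> (\<exists>z<n. ?X z \<and> ?B b z)"
        unfolding base_iff using touched_if_leaving ab(1,2) by blast
    next
      fix a b c
      show "?B a a" by (simp add: base_iff)
      show "?B a b \<Longrightarrow> ?B b a" unfolding base_iff by (rule conn_sym)
      show "?B a b \<Longrightarrow> ?B b c \<Longrightarrow> ?B a c" unfolding base_iff by (rule conn_trans)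
    qed (rule uv assms(3))+
  qed
  then show ?thesis using reach_sound assms(3,4) union by blast
qed

abbreviation K :: graph where
  "K \<equiv> kruskal (F \<inter> E) E (key n)"

lemma K_subset: "F \<inter> E \<subseteq> K" "K \<subseteq> E"
proof
  fix e assume e: "e \<in> F \<inter> E"
  then obtain a b where "e = {a, b}" using edges_onE[of e F n] forest(2) by blast
  then show "e \<in> K" using e by (simp add: kruskal_iff)
qed (rule kruskal_subset)

lemma H_loop: "H x x = F \<inter> E"
  using no_loop[of x] by (auto simp: H_def)

lemma new_conn_iff:
  assumes "u < n" "v < n"
  shows "new_conn L t n E P u v \<longleftrightarrow> (u, v) \<in> conn E"
proof -
  have "F \<inter> E \<union> E = E" by blast
  then show ?thesis
    unfolding new_conn_def using assms by (subst reach_iff_conn[of _ E]) (simp_all add: H_loop)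
qed

lemma new_tree_iff:
  assumes "x < n" "y < n"
  shows "new_tree L t n E P x y \<longleftrightarrow> {x, y} \<in> K"
proof -
  have "reach L t n (base n E P x x) (touched n E P x x) (\<lambda>a b. {a, b} \<in> E \<and> pair_less a b x y) x y
      \<longleftrightarrow> (x, y) \<in> conn (H x x \<union> {e \<in> E. key n e < key n {x, y}})"
    by (rule reach_iff_conn) (use assms in \<open>auto simp: key_less\<close>)
  then show ?thesis unfolding new_tree_def kruskal_iff P_edge H_loop by blast
qed

lemma new_path_iff:
  assumes "x < n" "y < n" "u < n" "v < n"
  shows "new_path L t n E P x y u v \<longleftrightarrow>
    {x, y} \<in> K \<and> (u, v) \<in> conn K \<and> (u, v) \<notin> conn (K - {{x, y}})"
proof -
  have "reach L t n (base n E P x y) (touched n E P x y)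
      (\<lambda>a b. new_tree L t n E P a b \<and> \<not> (a = x \<and> b = y) \<and> \<not> (a = y \<and> b = x)) u v
      \<longleftrightarrow> (u, v) \<in> conn (H x y \<union> (K - {{x, y}}))"
    by (rule reach_iff_conn) (use assms K_subset in \<open>auto simp: new_tree_iff doubleton_eq_iff\<close>)
  moreover have "H x y \<union> (K - {{x, y}}) = K - {{x, y}}"
    using K_subset unfolding H_def by blast
  moreover have "conn K = conn E" by (rule conn_kruskal) blast
  ultimately show ?thesis
    unfolding new_path_def using assms by (simp add: new_tree_iff new_conn_iff)
qed

lemma forest_K: "forest K"
proof (rule forest_kruskal)
  have "forest (F \<inter> E)"
    unfolding forest_def
  proof (intro allI impI notI)
    fix a b assume "{a, b} \<in> F \<inter> E" "(a, b) \<in> conn (F \<inter> E - {{a, b}})"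
    moreover have "conn (F \<inter> E - {{a, b}}) \<subseteq> conn (F - {{a, b}})" by (rule conn_mono) blast
    ultimately show False using forest(1) unfolding forest_def by blast
  qed
  then show "forest (F \<inter> E)" .
  show "inj_on (key n) E" using inj_on_key E by (rule inj_on_subset)
qed (use E in auto)

end

section \<open>The invariant along a sequence of changes\<close>

definition invariant :: "nat \<Rightarrow> state \<Rightarrow> bool" where
  "invariant n S \<longleftrightarrow> fst S \<subseteq> edges_on n \<and> (\<exists>F. forest F \<and> F \<subseteq> fst S \<and> conn F = conn (fst S) \<and>
     (\<forall>a b u v. [a, b, u, v] \<in> snd S 0 \<longleftrightarrow>
        {a, b} \<in> F \<and> (u, v) \<in> conn F \<and> (u, v) \<notin> conn (F - {{a, b}})))"

text \<open>The empty path relation describes the empty forest. The invariant leaves out the answer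
  relation, whose initial value lacks the diagonal; it is computed afresh by each update.\<close>

lemma invariant_initial: "invariant n initial_state"
  unfolding invariant_def initial_state_def by (auto intro!: exI[of _ "{}"] simp: forest_def)

lemma card_Union_edges:
  assumes "C \<subseteq> edges_on n"
  shows "card (\<Union> C) \<le> 2 * card C"
proof -
  have "card (\<Union> C) \<le> sum card C"
    by (rule card_Union_le_sum_card)
  also have "\<dots> \<le> (\<Sum>e\<in>C. 2)"
    by (rule sum_mono) (use assms card_2_iff' in \<open>force simp: edges_on_def card_insert_if\<close>)
  finally show ?thesis by simp
qed

lemma card_ends_le:
  assumes \<delta>: "change_on n \<delta>" and F: "F \<subseteq> E" "conn F = conn E"
    and E': "E' = apply_change \<delta> E"
  shows "card {z. z < n \<and> (\<exists>w. {z, w} \<in> F - E' \<or> {z, w} \<in> E' \<and> (z, w) \<notin> conn F)} \<le> 2 * change_size \<delta>"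
proof -
  let ?C = "fst \<delta> \<union> snd \<delta>"
  have C: "?C \<subseteq> edges_on n" using \<delta> by (simp add: change_on_def)
  have "\<Union> ?C \<subseteq> {..<n}" using C by (auto simp: edges_on_def)
  then have "finite (\<Union> ?C)" by (rule finite_subset) simp
  \<comment> \<open>A forest edge that is gone was deleted; an edge between components of
    \<open>F\<close> was not in \<open>E\<close>, since \<open>F\<close> and \<open>E\<close> have
    the same connectivity.\<close>
  moreover have "{z, w} \<in> ?C" if "{z, w} \<in> F - E' \<or> {z, w} \<in> E' \<and> (z, w) \<notin> conn F" for z w
    using that F(1) conn_edge[of z w E] unfolding E' apply_change_def F(2) by blast
  ultimately have "card {z. z < n \<and> (\<exists>w. {z, w} \<in> F - E' \<or> {z, w} \<in> E' \<and> (z, w) \<notin> conn F)}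
      \<le> card (\<Union> ?C)"
    by (intro card_mono) blast+
  also have "\<dots> \<le> 2 * card ?C" using C by (rule card_Union_edges)
  also have "\<dots> \<le> 2 * change_size \<delta>"
    unfolding change_size_def using card_Un_le[of "fst \<delta>" "snd \<delta>"] by simp
  finally show ?thesis .
qed

theorem theorem7:
  fixes c :: nat
  shows "reachability \<in> DynFO (\<lambda>n. (log 2 (real n)) ^ c)"
proof -
  obtain L t where capacity: "\<And>n. capacity L t n (2 + 2 * log 2 (real n) ^ c)"
    using ex_capacity by blast
  obtain \<phi> \<psi> where wf: "wf_program (Program [(4, \<phi>), (2, \<psi>)] 1)"
    and \<phi>: "\<And>n E A. defined_relation n (interp n E A) 4 \<phi> = {[x, y, u, v] |x y u v.
       x < n \<and> y < n \<and> u < n \<and> v < n \<and> new_path L t n E (\<lambda>a b u v. [a, b, u, v] \<in> A 0) x y u v}"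
    and \<psi>: "\<And>n E A. defined_relation n (interp n E A) 2 \<psi> = {[u, v] |u v.
       u < n \<and> v < n \<and> new_conn L t n E (\<lambda>a b u v. [a, b, u, v] \<in> A 0) u v}"
    using ex_program[of L t] by blast
  define Pr where "Pr = Program [(4, \<phi>), (2, \<psi>)] 1"
  have step: "invariant n (update_state Pr n \<delta> S) \<and>
      snd (update_state Pr n \<delta> S) 1 = reachability n (fst (update_state Pr n \<delta> S))"
    if inv: "invariant n S" and \<delta>: "change_on n \<delta>" "real (change_size \<delta>) \<le> log 2 (real n) ^ c"
    for n \<delta> S
  proof -
    define E where "E = apply_change \<delta> (fst S)"
    obtain A' where S': "update_state Pr n \<delta> S = (E, A')"
      and A': "A' 0 = defined_relation n (interp n E (snd S)) 4 \<phi>"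
        "A' 1 = defined_relation n (interp n E (snd S)) 2 \<psi>"
      unfolding update_state_def Let_def E_def Pr_def by simp
    obtain F where F: "forest F" "F \<subseteq> fst S" "conn F = conn (fst S)"
      "\<And>a b u v. [a, b, u, v] \<in> snd S 0 \<longleftrightarrow>
        {a, b} \<in> F \<and> (u, v) \<in> conn F \<and> (u, v) \<notin> conn (F - {{a, b}})"
      and S: "fst S \<subseteq> edges_on n"
      using inv unfolding invariant_def by blast
    have E: "E \<subseteq> edges_on n"
      using S \<delta>(1) unfolding E_def apply_change_def change_on_def by blast
    interpret forest_update n L t F E "\<lambda>a b u v. [a, b, u, v] \<in> snd S 0" "2 + 2 * log 2 (real n) ^ c"
    proof
      show "F \<subseteq> edges_on n" using F(2) S by blast
      show "real (card {z. z < n \<and> (\<exists>w. {z, w} \<in> F - E \<or> {z, w} \<in> E \<and> (z, w) \<notin> conn F)}) + 2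
          \<le> 2 + 2 * log 2 (real n) ^ c"
        using card_ends_le[OF \<delta>(1) F(2,3) E_def] \<delta>(2) by linarith
    qed (use F(1) E F(4) capacity in blast)+
    have "A' 1 = reachability n E"
      unfolding A' \<psi> reachability_def conn_def[symmetric] using new_conn_iff by blast
    moreover have "[x, y, u, v] \<in> A' 0 \<longleftrightarrow>
        {x, y} \<in> K \<and> (u, v) \<in> conn K \<and> (u, v) \<notin> conn (K - {{x, y}})" for x y u v
    proof -
      \<comment> \<open>The invariant ranges over all numbers, so tuples beyond \<open>n\<close>
        must fail on both sides. Since \<open>u \<noteq> v\<close>, both nodes are ends of edges of
        \<open>K\<close> and hence below \<open>n\<close>.\<close>
      have "x < n \<and> y < n \<and> u < n \<and> v < n"
        if *: "{x, y} \<in> K" "(u, v) \<in> conn K" "(u, v) \<notin> conn (K - {{x, y}})"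
      proof -
        have KE: "K \<subseteq> edges_on n" using K_subset(2) E by blast
        have "u \<noteq> v" using * by auto
        then have "\<exists>w. {u, w} \<in> K" "\<exists>w. {v, w} \<in> K"
          using *(2) conn_sym[OF *(2)] unfolding conn_def by (auto elim: converse_rtranclE)
        then show ?thesis using *(1) edges_on_less KE by blast
      qed
      then show ?thesis unfolding A' \<phi> using new_path_iff by blast
    qed
    moreover have "conn K = conn E" by (rule conn_kruskal) blast
    ultimately show ?thesis
      unfolding S' invariant_def using E forest_K K_subset(2) by auto
  qed
  have inv: "invariant n (run Pr n \<delta>s) \<and> (\<delta>s \<noteq> [] \<longrightarrow>
      snd (run Pr n \<delta>s) 1 = reachability n (fst (run Pr n \<delta>s)))"
    if "\<forall>\<delta>\<in>set \<delta>s. change_on n \<delta> \<and> real (change_size \<delta>) \<le> log 2 (real n) ^ c" for n \<delta>s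
    using that
  proof (induction \<delta>s rule: rev_induct)
    case Nil
    then show ?case by (simp add: run_def invariant_initial)
  next
    case (snoc \<delta> \<delta>s)
    then show ?case using step[of n "run Pr n \<delta>s" \<delta>] by (simp add: run_def)
  qed
  have "maintains Pr (\<lambda>n. (log 2 (real n)) ^ c) reachability"
    unfolding maintains_def using inv by (simp add: Pr_def)
  then show ?thesis using wf unfolding DynFO_def Pr_def by blast
qed

end
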